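(* Let $d\ge 2$ be an integer, $\mu>-1/2$ and $\lambda>0$. For $n\in\mathbb{N}_0$ and $0\le k\le n/2$, let $\{Y_\nu^{n-2k} : 1\le \nu\le a_{n-2k}^d\}$ be an orthonormal basis of $\mathcal{H}_{n-2k}^d$. Let $\beta_k=n-2k+\frac{d-2}{2}$ and let $q_k^{(\mu-1/2,\beta_k,\lambda)}(t)$ be the $k$-th orthogonal polynomial (of exact degree $k$) with respect to the univariate inner product $$(f,g)_{\mu-1/2,\beta_k}^{\lambda}=\frac{\sigma_{d-1}}{\omega_\mu}\,\frac{1}{2^{\mu+\beta_k+3/2}}\int_{-1}^1 f(t)g(t)(1-t)^{\mu-1/2}(1+t)^{\beta_k}\,dt+\lambda f(1)g(1).$$ Then the polynomials $$Q_{k,\nu}^n(x)=q_k^{(\mu-1/2,\beta_k,\lambda)}\big(2\|x\|^2-1\big)\,Y_\nu^{n-2k}(x),\qquad 0\le k\le n/2,\quad 1\le\nu\le a_{n-2k}^d,$$ constitute a mutually orthogonal basis of $\mathcal{V}_n^d(W_\mu,\lambda)$.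
   Context: $\mathbb{B}^d=\{x\in\mathbb{R}^d:\|x\|\le 1\}$ and $\mathbb{S}^{d-1}=\{\xi\in\mathbb{R}^d:\|\xi\|=1\}$, with $\|\cdot\|$ the Euclidean norm; $d\sigma$ is the surface measure on $\mathbb{S}^{d-1}$ and $\sigma_{d-1}=\int_{\mathbb{S}^{d-1}}d\sigma=2\pi^{d/2}/\Gamma(d/2)$. The weight is $W_\mu(x)=(1-\|x\|^2)^{\mu-1/2}$ on $\mathbb{B}^d$, and $\omega_\mu=\int_{\mathbb{B}^d}W_\mu(x)\,dx=\pi^{d/2}\Gamma(\mu+1/2)/\Gamma(\mu+(d+1)/2)$. The inner product on real polynomials in $d$ variables is $$\langle f,g\rangle_\mu^\lambda=\frac{1}{\omega_\mu}\int_{\mathbb{B}^d}f(x)g(x)W_\mu(x)\,dx+\frac{\lambda}{\sigma_{d-1}}\int_{\mathbb{S}^{d-1}}f(\xi)g(\xi)\,d\sigma(\xi).$$ $\Pi_n^d$ is the space of real polynomials in $d$ variables of total degree at most $n$ (with $\Pi_{-1}^d=\{0\}$). $\mathcal{V}_n^d(W_\mu,\lambda)$ is the linear space of orthogonal polynomials of degree exactly $n$ with respect to $\langle\cdot,\cdot\rangle_\mu^\lambda$, i.e. the space of all $P\in\Pi_n^d$ such that $\langle P,Q\rangle_\mu^\lambda=0$ for all $Q\in\Pi_{n-1}^d$. A basis is mutually orthogonal if any two distinct elements of it are orthogonal with respect to $\langle\cdot,\cdot\rangle_\mu^\lambda$. $\mathcal{H}_m^d$ is the space of real homogeneous polynomials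 $Y$ of degree $m$ in $d$ variables with $\Delta Y=0$, and $a_m^d=\dim\mathcal{H}_m^d$. Orthonormality in $\mathcal{H}_m^d$ is with respect to $\langle f,g\rangle_{\mathbb{S}^{d-1}}=\frac{1}{\sigma_{d-1}}\int_{\mathbb{S}^{d-1}}f(\xi)g(\xi)\,d\sigma(\xi)$. The "$k$-th orthogonal polynomial" of a univariate inner product is a polynomial of degree exactly $k$ orthogonal to all polynomials of degree less than $k$ (unique up to a nonzero constant factor). *)

theory Defs
  imports
    "HOL-Analysis.Analysis"
    "HOL-Library.Function_Algebras"
    "HOL-Computational_Algebra.Polynomial"
begin

section \<open>Real-valued functions as a vector space\<close>

instantiation "fun" :: (type, real_vector) real_vector
begin

definition scaleR_fun :: "real \<Rightarrow> ('a \<Rightarrow> 'b) \<Rightarrow> 'a \<Rightarrow> 'b" where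
  "scaleR_fun c f = (\<lambda>x. c *\<^sub>R f x)"

instance
  by standard (simp_all add: scaleR_fun_def fun_eq_iff scaleR_add_right scaleR_add_left)

end

definition basis_family :: "'i set \<Rightarrow> ('i \<Rightarrow> 'v::real_vector) \<Rightarrow> 'v set \<Rightarrow> bool" where
  "basis_family I b V \<longleftrightarrow> inj_on b I \<and> independent (b ` I) \<and> span (b ` I) = V"

definition mutually_orthogonal :: "('v \<Rightarrow> 'v \<Rightarrow> real) \<Rightarrow> 'i set \<Rightarrow> ('i \<Rightarrow> 'v) \<Rightarrow> bool" where
  "mutually_orthogonal ip I b \<longleftrightarrow> (\<forall>i\<in>I. \<forall>j\<in>I. i \<noteq> j \<longrightarrow> ip (b i) (b j) = 0)"

definition orthonormal_basis_family ::
    "('v \<Rightarrow> 'v \<Rightarrow> real) \<Rightarrow> 'i set \<Rightarrow> ('i \<Rightarrow> 'v::real_vector) \<Rightarrow> 'v set \<Rightarrow> bool" where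
  "orthonormal_basis_family ip I b V \<longleftrightarrow>
     basis_family I b V \<and> mutually_orthogonal ip I b \<and> (\<forall>i\<in>I. ip (b i) (b i) = 1)"

section \<open>Polynomials in several variables\<close>

text \<open>
  A real polynomial in \<open>d = CARD('n)\<close> variables is represented by the function it induces
  on \<open>real ^ 'n\<close>; over the infinite field of real numbers this loses nothing.
\<close>

definition monomial_fun :: "('n::finite \<Rightarrow> nat) \<Rightarrow> real ^ 'n \<Rightarrow> real" where
  "monomial_fun \<alpha> x = (\<Prod>i\<in>UNIV. (x $ i) ^ \<alpha> i)"

text \<open>The bound is an integer, so that \<open>poly_space (-1) = {0}\<close>.\<close>

definition poly_space :: "int \<Rightarrow> (real ^ 'n::finite \<Rightarrow> real) set" where
  "poly_space m = span {monomial_fun \<alpha> | \<alpha>. int (\<Sum>i\<in>UNIV. \<alpha> i) \<le> m}"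

definition homogeneous_space :: "nat \<Rightarrow> (real ^ 'n::finite \<Rightarrow> real) set" where
  "homogeneous_space m = span {monomial_fun \<alpha> | \<alpha>. (\<Sum>i\<in>UNIV. \<alpha> i) = m}"

definition partial_deriv :: "'n::finite \<Rightarrow> (real ^ 'n \<Rightarrow> real) \<Rightarrow> real ^ 'n \<Rightarrow> real" where
  "partial_deriv i f x = deriv (\<lambda>t. f (x + t *\<^sub>R axis i 1)) 0"

definition laplacian :: "(real ^ 'n::finite \<Rightarrow> real) \<Rightarrow> real ^ 'n \<Rightarrow> real" where
  "laplacian f x = (\<Sum>i\<in>UNIV. partial_deriv i (partial_deriv i f) x)"

definition harmonic_space :: "nat \<Rightarrow> (real ^ 'n::finite \<Rightarrow> real) set" where
  "harmonic_space m = {Y \<in> homogeneous_space m. \<forall>x. laplacian Y x = 0}"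

definition harmonic_dim :: "'n::finite itself \<Rightarrow> nat \<Rightarrow> nat" where
  "harmonic_dim _ m = dim (harmonic_space m :: (real ^ 'n \<Rightarrow> real) set)"

section \<open>Surface measure on the unit sphere\<close>

text \<open>
  The surface measure of a Borel set \<open>A\<close> of unit vectors is \<open>d\<close> times the Lebesgue measure of
  the cone \<open>{r *\<^sub>R \<xi> | r \<xi>. 0 < r \<and> r \<le> 1 \<and> \<xi> \<in> A}\<close>. Recall that \<open>sgn x = x /\<^sub>R norm x\<close>.
\<close>

definition sphere_surface :: "(real ^ 'n::finite) measure" where
  "sphere_surface =
     distr (scale_measure (of_nat CARD('n)) (restrict_space lborel (cball 0 1 - {0})))
       (restrict_space borel (sphere 0 1)) sgn"

lemma space_sphere_surface [simp]: "space (sphere_surface :: (real ^ 'n::finite) measure) = sphere 0 1"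
  by (simp add: sphere_surface_def)

lemma sets_sphere_surface [simp, measurable_cong]:
  "sets (sphere_surface :: (real ^ 'n::finite) measure) = sets (restrict_space borel (sphere 0 1))"
  by (simp add: sphere_surface_def)

lemma emeasure_sphere_surface:
  fixes A :: "(real ^ 'n::finite) set"
  assumes "A \<in> sets borel" and "A \<subseteq> sphere 0 1"
  shows "emeasure sphere_surface A =
    of_nat CARD('n) * emeasure lborel {r *\<^sub>R \<xi> | r \<xi>. 0 < r \<and> r \<le> 1 \<and> \<xi> \<in> A}"
proof -
  let ?B = "cball 0 1 - {0} :: (real ^ 'n) set"
  let ?M = "scale_measure (of_nat CARD('n)) (restrict_space lborel ?B)"
  have sgn_b: "(sgn :: real ^ 'n \<Rightarrow> real ^ 'n) \<in> borel_measurable borel"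
    unfolding sgn_div_norm by measurable
  have m: "sgn \<in> measurable ?M (restrict_space borel (sphere 0 1))"
    by (rule measurable_restrict_space2)
       (auto simp: space_scale_measure norm_sgn measurable_cong_sets[OF sets_scale_measure refl]
             intro!: measurable_restrict_space1 sgn_b)
  have A: "A \<in> sets (restrict_space borel (sphere 0 1))"
    using assms by (auto simp: sets_restrict_space_iff)
  have eq: "sgn -` A \<inter> space ?M = {r *\<^sub>R \<xi> | r \<xi>. 0 < r \<and> r \<le> 1 \<and> \<xi> \<in> A}"
  proof (intro equalityI subsetI)
    fix x assume "x \<in> sgn -` A \<inter> space ?M"
    then have x: "sgn x \<in> A" "norm x \<le> 1" "x \<noteq> 0"
      by (auto simp: space_scale_measure)
    then have "x = norm x *\<^sub>R sgn x" by (simp add: sgn_div_norm)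
    then show "x \<in> {r *\<^sub>R \<xi> | r \<xi>. 0 < r \<and> r \<le> 1 \<and> \<xi> \<in> A}"
      using x by (intro CollectI exI[of _ "norm x"] exI[of _ "sgn x"]) auto
  next
    fix x assume "x \<in> {r *\<^sub>R \<xi> | r \<xi>. 0 < r \<and> r \<le> 1 \<and> \<xi> \<in> A}"
    then obtain r \<xi> where r: "x = r *\<^sub>R \<xi>" "0 < r" "r \<le> 1" "\<xi> \<in> A" by blast
    then have "norm \<xi> = 1" using assms by auto
    then show "x \<in> sgn -` A \<inter> space ?M"
      using r by (auto simp: space_scale_measure sgn_div_norm)
  qed
  have "sgn -` A \<inter> space ?M \<subseteq> ?B" by (auto simp: space_scale_measure)
  then show ?thesis
    unfolding sphere_surface_def emeasure_distr[OF m A] emeasure_scale_measure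
    by (subst emeasure_restrict_space) (simp_all add: eq)
qed

definition sphere_area :: "'n::finite itself \<Rightarrow> real" where
  "sphere_area _ = (\<integral>\<xi>. 1 \<partial>(sphere_surface :: (real ^ 'n) measure))"

lemma sphere_area_eq:
  "sphere_area TYPE('n::finite) =
     2 * pi powr (real CARD('n) / 2) / Gamma (real CARD('n) / 2)"
proof -
  let ?d = "real CARD('n)"
  have B: "{r *\<^sub>R \<xi> | r \<xi>. 0 < r \<and> r \<le> 1 \<and> \<xi> \<in> sphere 0 1} = (cball 0 1 - {0} :: (real ^ 'n) set)"
  proof (intro equalityI subsetI)
    fix x :: "real ^ 'n" assume "x \<in> cball 0 1 - {0}"
    then show "x \<in> {r *\<^sub>R \<xi> | r \<xi>. 0 < r \<and> r \<le> 1 \<and> \<xi> \<in> sphere 0 1}"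
      by (intro CollectI exI[of _ "norm x"] exI[of _ "sgn x"]) (auto simp: sgn_div_norm)
  qed auto
  have "emeasure lborel (cball 0 1 - {0} :: (real ^ 'n) set) = emeasure lborel (cball 0 1 :: (real ^ 'n) set)"
    by (rule emeasure_Diff_null_set) (auto intro: null_setsI)
  also have "\<dots> = ennreal (unit_ball_vol ?d)"
    by (simp add: emeasure_cball)
  finally have "emeasure sphere_surface (sphere 0 1 :: (real ^ 'n) set) = ennreal (?d * unit_ball_vol ?d)"
    by (subst emeasure_sphere_surface, simp, simp, subst B)
       (simp add: ennreal_mult ennreal_of_nat_eq_real_of_nat)
  then have "sphere_area TYPE('n) = ?d * unit_ball_vol ?d"
    by (simp add: sphere_area_def measure_def)
  also have "\<dots> = 2 * pi powr (?d / 2) / Gamma (?d / 2)"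
  proof -
    have "?d / 2 > 0" by simp
    then have "?d / 2 \<notin> \<int>\<^sub>\<le>\<^sub>0" 
      using nonpos_Ints_nonpos[of "?d / 2"] by linarith
    then have G: "Gamma (?d / 2 + 1) = ?d / 2 * Gamma (?d / 2)" by (rule Gamma_plus1)
    have "Gamma (?d / 2) > 0" by (rule Gamma_real_pos) simp
    then show ?thesis unfolding unit_ball_vol_def G by (simp add: divide_simps)
  qed
  finally show ?thesis .
qed

definition sphere_ip :: "(real ^ 'n::finite \<Rightarrow> real) \<Rightarrow> (real ^ 'n \<Rightarrow> real) \<Rightarrow> real" where
  "sphere_ip f g = 1 / sphere_area TYPE('n) * (\<integral>\<xi>. f \<xi> * g \<xi> \<partial>sphere_surface)"

section \<open>The inner product on the ball and its orthogonal polynomials\<close>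

text \<open>
  Since \<open>0 powr a = 0\<close> for every \<open>a\<close>, the weight is \<open>0\<close> on the boundary sphere; this is a Lebesgue
  null set, so the integrals below do not depend on it.
\<close>

definition ball_weight :: "real \<Rightarrow> real ^ 'n::finite \<Rightarrow> real" where
  "ball_weight \<mu> x = (1 - (norm x)\<^sup>2) powr (\<mu> - 1 / 2)"

definition ball_weight_mass :: "'n::finite itself \<Rightarrow> real \<Rightarrow> real" where
  "ball_weight_mass _ \<mu> = (LINT x:(cball 0 1 :: (real ^ 'n) set)|lborel. ball_weight \<mu> x)"

definition ball_ip ::
    "real \<Rightarrow> real \<Rightarrow> (real ^ 'n::finite \<Rightarrow> real) \<Rightarrow> (real ^ 'n \<Rightarrow> real) \<Rightarrow> real" where
  "ball_ip \<mu> l f g =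
     1 / ball_weight_mass TYPE('n) \<mu> *
       (LINT x:cball 0 1|lborel. f x * g x * ball_weight \<mu> x)
     + l / sphere_area TYPE('n) * (\<integral>\<xi>. f \<xi> * g \<xi> \<partial>sphere_surface)"

definition orth_poly_space :: "real \<Rightarrow> real \<Rightarrow> nat \<Rightarrow> (real ^ 'n::finite \<Rightarrow> real) set" where
  "orth_poly_space \<mu> l n =
     {P \<in> poly_space (int n). \<forall>Q \<in> poly_space (int n - 1). ball_ip \<mu> l P Q = 0}"

section \<open>The univariate inner product\<close>

definition jacobi_mass_ip ::
    "'n::finite itself \<Rightarrow> real \<Rightarrow> real \<Rightarrow> real \<Rightarrow> real poly \<Rightarrow> real poly \<Rightarrow> real" where
  "jacobi_mass_ip _ \<mu> \<beta> l f g =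
     sphere_area TYPE('n) / ball_weight_mass TYPE('n) \<mu> * (1 / 2 powr (\<mu> + \<beta> + 3 / 2)) *
       (LINT t:{-1..1}|lborel. poly f t * poly g t * (1 - t) powr (\<mu> - 1 / 2) * (1 + t) powr \<beta>)
     + l * poly f 1 * poly g 1"

text \<open>
  The condition \<open>q \<noteq> 0\<close> matters for \<open>k = 0\<close> only, because \<open>degree 0 = 0\<close> in the library.
\<close>

definition is_kth_orth_poly :: "(real poly \<Rightarrow> real poly \<Rightarrow> real) \<Rightarrow> nat \<Rightarrow> real poly \<Rightarrow> bool" where
  "is_kth_orth_poly ip k q \<longleftrightarrow>
     q \<noteq> 0 \<and> degree q = k \<and> (\<forall>p. degree p < k \<longrightarrow> ip q p = 0)"

end

theory Submission
  imports Defs "HOL-Probability.Distributions"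
begin

text \<open>
  Every homogeneous polynomial is a sum of products \<open>(norm x)\<^sup>2 ^ j * Y x\<close> with harmonic \<open>Y\<close>, and
  harmonic polynomials of different degrees are orthogonal on the sphere. In polar coordinates the
  inner product of \<open>p (2 * (norm x)\<^sup>2 - 1) * Y x\<close> and \<open>q (2 * (norm x)\<^sup>2 - 1) * Z x\<close>, for harmonic \<open>Y\<close>
  and \<open>Z\<close> of equal degree, factors after the substitution \<open>t = 2 * r\<^sup>2 - 1\<close> into the univariate
  inner product of \<open>p\<close> and \<open>q\<close> and the spherical one of \<open>Y\<close> and \<open>Z\<close>. Hence the given polynomials
  are mutually orthogonal elements of the space. They span it: a polynomial of degree at most \<open>n\<close> is
  a linear combination of them up to a remainder of degree less than \<open>n\<close>, and a remainder that
  also lies in the space is orthogonal to itself, hence zero.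
\<close>

section \<open>Homogeneous and harmonic polynomials\<close>

text \<open>The surface measure is given only through volumes of cones, so facts about the sphere
  are drawn from integrals over the whole space. This shapes the orthogonality of harmonic
  polynomials: in place of Green's formula on the ball with its boundary term, the weight
  \<open>exp (- (norm x)\<^sup>2)\<close> is integrated over all of space. There integration by
  parts has no boundary term and reduces to one-dimensional moments, and polar coordinates carry the
  result back to the sphere.

  The parameters of the univariate inner product come from \<open>t = 2 * r\<^sup>2 - 1\<close>, for
  which \<open>1 - t = 2 * (1 - r\<^sup>2)\<close>, \<open>1 + t = 2 * r\<^sup>2\<close> and
  \<open>dt = 4 * r dr\<close>. Two harmonic factors of degree \<open>m\<close> leave the radial
  density \<open>r ^ (2 * m + d - 1)\<close>, which is \<open>r\<close> times the power
  \<open>m + (d - 2) / 2\<close> of \<open>r\<^sup>2\<close>; this exponent is \<beta>. The powers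
  of 2 collect to \<open>2 powr (\<mu> + \<beta> + 3 / 2)\<close>. The unit sphere corresponds to
  \<open>t = 1\<close>, whence the point mass there.\<close>

definition polyfun :: "(real ^ 'n::finite \<Rightarrow> real) set" where
  "polyfun = span (range monomial_fun)"

lemma fun_scaleR_apply [simp]: "(c *\<^sub>R f) x = c *\<^sub>R f x"
  by (simp add: scaleR_fun_def)

lemma sum_fun_apply: "(\<Sum>i\<in>I. f i) x = (\<Sum>i\<in>I. f i x)"
  by (induction I rule: infinite_finite_induct) auto

lemma homogeneous_subset_polyfun: "homogeneous_space m \<subseteq> polyfun"
  unfolding homogeneous_space_def polyfun_def by (rule span_mono) auto

lemma poly_space_subset_polyfun: "poly_space m \<subseteq> polyfun"
  unfolding poly_space_def polyfun_def by (rule span_mono) auto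

lemma homogeneous_subset_poly_space:
  "int m \<le> k \<Longrightarrow> homogeneous_space m \<subseteq> poly_space k"
  unfolding homogeneous_space_def poly_space_def by (rule span_mono) auto

lemma poly_space_mono: "j \<le> k \<Longrightarrow> poly_space j \<subseteq> poly_space k"
  unfolding poly_space_def by (rule span_mono) auto

lemma subspace_polyfun: "subspace polyfun"
  by (simp add: polyfun_def)

lemma subspace_poly_space: "subspace (poly_space m)"
  by (simp add: poly_space_def)

lemma subspace_homogeneous: "subspace (homogeneous_space m)"
  by (simp add: homogeneous_space_def)

lemma monomial_fun_mult:
  "monomial_fun \<alpha> x * monomial_fun \<beta> x = monomial_fun (\<lambda>i. \<alpha> i + \<beta> i) x"
  by (simp add: monomial_fun_def power_add prod.distrib)

text \<open>The product is bilinear, so two nested span inductions reduce closure under products to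
  generators. Monomials then serve both the graded spaces and \<open>polyfun\<close>.\<close>

lemma span_mult_mem:
  fixes S T U :: "('a \<Rightarrow> real) set"
  assumes f: "f \<in> span S" and g: "g \<in> span T"
    and ST: "\<And>a b. a \<in> S \<Longrightarrow> b \<in> T \<Longrightarrow> (\<lambda>x. a x * b x) \<in> span U"
  shows "(\<lambda>x. f x * g x) \<in> span U"
  using f
proof (induction rule: span_induct_alt)
  case base
  then show ?case using span_0[of U] by (simp add: zero_fun_def)
next
  case (step c a f)
  have "(\<lambda>x. a x * g x) \<in> span U"
    using g
  proof (induction rule: span_induct_alt)
    case base
    then show ?case using span_0[of U] by (simp add: zero_fun_def)
  next
    case (step c b g)
    have "c *\<^sub>R (\<lambda>x. a x * b x) + (\<lambda>x. a x * g x) \<in> span U"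
      by (intro span_add span_scale step ST \<open>a \<in> S\<close>)
    then show ?case by (simp add: plus_fun_def scaleR_fun_def algebra_simps)
  qed
  then have "c *\<^sub>R (\<lambda>x. a x * g x) + (\<lambda>x. f x * g x) \<in> span U"
    by (intro span_add span_scale step)
  then show ?case by (simp add: plus_fun_def scaleR_fun_def algebra_simps)
qed

lemma homogeneous_mult:
  assumes "f \<in> homogeneous_space a" and "g \<in> homogeneous_space b"
  shows "(\<lambda>x. f x * g x) \<in> homogeneous_space (a + b)"
  using assms unfolding homogeneous_space_def
  by (rule span_mult_mem) (auto intro!: span_base simp: monomial_fun_mult sum.distrib)

lemma polyfun_mult:
  assumes "f \<in> polyfun" and "g \<in> polyfun"
  shows "(\<lambda>x. f x * g x) \<in> polyfun"
  using assms unfolding polyfun_def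
  by (rule span_mult_mem) (auto intro!: span_base simp: monomial_fun_mult)

lemma one_homogeneous: "(\<lambda>x. 1) \<in> homogeneous_space 0"
  unfolding homogeneous_space_def
  by (rule span_base) (auto simp: monomial_fun_def fun_eq_iff intro!: exI[of _ "\<lambda>_. 0"])

lemma coordinate_homogeneous: "(\<lambda>x. x $ i) \<in> homogeneous_space 1"
proof -
  have "(\<lambda>x. x $ i) = monomial_fun (\<lambda>j. if j = i then 1 else 0)"
    by (simp add: monomial_fun_def fun_eq_iff if_distrib[of "\<lambda>k. _ ^ k"] prod.delta cong: if_cong)
  then show ?thesis
    unfolding homogeneous_space_def by (intro span_base) auto
qed

lemma norm_squared_eq: "(norm (x :: real ^ 'n::finite))\<^sup>2 = (\<Sum>i\<in>UNIV. x $ i * x $ i)"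
  by (simp add: power2_norm_eq_inner inner_vec_def)

lemma norm_squared_homogeneous: "(\<lambda>x. (norm x)\<^sup>2) \<in> homogeneous_space 2"
proof -
  have "(\<lambda>x::real^'n. x $ i * x $ i) \<in> homogeneous_space 2" for i
    using homogeneous_mult[OF coordinate_homogeneous coordinate_homogeneous] by (simp add: numeral_2_eq_2)
  then have "(\<Sum>i\<in>UNIV. (\<lambda>x::real^'n. x $ i * x $ i)) \<in> homogeneous_space 2"
    by (rule subspace_sum[OF subspace_homogeneous])
  then show ?thesis by (simp add: norm_squared_eq sum_fun_apply[abs_def])
qed

lemma norm_power_mult_homogeneous:
  assumes "f \<in> homogeneous_space m"
  shows "(\<lambda>x. ((norm x)\<^sup>2) ^ j * f x) \<in> homogeneous_space (2 * j + m)"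
proof (induction j)
  case (Suc j)
  from homogeneous_mult[OF norm_squared_homogeneous Suc] show ?case
    by (simp add: mult.assoc)
qed (use assms in simp)

lemma homogeneous_scale:
  assumes "f \<in> homogeneous_space m"
  shows "f (c *\<^sub>R x) = c ^ m * f x"
  using assms unfolding homogeneous_space_def
proof (induction rule: span_induct_alt)
  case (step a g f)
  then obtain \<alpha> where "g = monomial_fun \<alpha>" "sum \<alpha> UNIV = m" by blast
  then have "g (c *\<^sub>R x) = c ^ m * g x"
    by (auto simp: monomial_fun_def power_mult_distrib prod.distrib power_sum)
  with step show ?case by (simp add: algebra_simps)
qed simp

lemma continuous_polyfun:
  assumes "f \<in> polyfun"
  shows "continuous_on UNIV f"
  using assms unfolding polyfun_def
proof (induction rule: span_induct_alt)
  case base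
  then show ?case by (simp add: zero_fun_def)
next
  case (step c g f)
  have "continuous_on UNIV g"
    using step(1) by (auto simp: monomial_fun_def[abs_def] intro!: continuous_intros)
  with step show ?case by (simp add: plus_fun_def scaleR_fun_def continuous_intros)
qed

lemma measurable_polyfun: "f \<in> polyfun \<Longrightarrow> f \<in> borel_measurable borel"
  by (intro borel_measurable_continuous_onI continuous_polyfun)

subsection \<open>Derivatives and the Laplacian\<close>

text \<open>\<open>partial_deriv\<close> rests on the choice operator \<open>deriv\<close>, which
  says nothing without differentiability. The rules of calculus are therefore proved for this
  relation and transferred by \<open>line_deriv_partial_deriv\<close>.\<close>

definition line_deriv :: "'n::finite \<Rightarrow> (real ^ 'n \<Rightarrow> real) \<Rightarrow> (real ^ 'n \<Rightarrow> real) \<Rightarrow> bool" where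
  "line_deriv i f f' \<longleftrightarrow> (\<forall>x. ((\<lambda>t. f (x + t *\<^sub>R axis i 1)) has_real_derivative f' x) (at 0))"

lemma line_deriv_partial_deriv: "line_deriv i f f' \<Longrightarrow> partial_deriv i f = f'"
  by (auto simp: line_deriv_def partial_deriv_def fun_eq_iff intro: DERIV_imp_deriv)

text \<open>For \<open>\<alpha> i = 0\<close> the truncated exponent \<open>\<alpha> i - 1\<close>
  is wrong, but the coefficient \<open>real (\<alpha> i)\<close> removes the term.\<close>

lemma line_deriv_monomial:
  "line_deriv i (monomial_fun \<alpha>) (\<lambda>x. real (\<alpha> i) * monomial_fun (\<alpha>(i := \<alpha> i - 1)) x)"
  unfolding line_deriv_def
proof
  fix x :: "real ^ 'a"
  have eq: "monomial_fun \<alpha> (x + t *\<^sub>R axis i 1)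
      = (x $ i + t) ^ \<alpha> i * (\<Prod>j\<in>UNIV - {i}. (x $ j) ^ \<alpha> j)" for t
    unfolding monomial_fun_def
    by (subst prod.remove[of UNIV i]) (auto simp: axis_def intro!: prod.cong)
  have eq': "monomial_fun (\<alpha>(i := \<alpha> i - 1)) x
      = (x $ i) ^ (\<alpha> i - 1) * (\<Prod>j\<in>UNIV - {i}. (x $ j) ^ \<alpha> j)"
    unfolding monomial_fun_def
    by (subst prod.remove[of UNIV i]) (auto intro!: prod.cong)
  show "((\<lambda>t. monomial_fun \<alpha> (x + t *\<^sub>R axis i 1)) has_real_derivative
      real (\<alpha> i) * monomial_fun (\<alpha>(i := \<alpha> i - 1)) x) (at 0)"
    unfolding eq eq' by (auto intro!: derivative_eq_intros)
qed

lemma line_deriv_zero: "line_deriv i 0 0"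
  by (simp add: line_deriv_def)

lemma line_deriv_add:
  "line_deriv i f f' \<Longrightarrow> line_deriv i g g' \<Longrightarrow> line_deriv i (\<lambda>x. f x + g x) (\<lambda>x. f' x + g' x)"
  by (auto simp: line_deriv_def intro!: derivative_eq_intros)

lemma line_deriv_lincomb:
  "line_deriv i f f' \<Longrightarrow> line_deriv i g g' \<Longrightarrow> line_deriv i (c *\<^sub>R f + g) (c *\<^sub>R f' + g')"
  by (auto simp: line_deriv_def intro!: derivative_eq_intros)

lemma line_deriv_mult:
  assumes "line_deriv i f f'" and "line_deriv i g g'"
  shows "line_deriv i (\<lambda>x. f x * g x) (\<lambda>x. f' x * g x + f x * g' x)"
  unfolding line_deriv_def
proof
  fix x
  show "((\<lambda>t. f (x + t *\<^sub>R axis i 1) * g (x + t *\<^sub>R axis i 1)) has_real_derivative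
      f' x * g x + f x * g' x) (at 0)"
    using assms DERIV_mult[of "\<lambda>t. f (x + t *\<^sub>R axis i 1)" "f' x" 0 UNIV "\<lambda>t. g (x + t *\<^sub>R axis i 1)" "g' x"]
    by (simp add: line_deriv_def algebra_simps)
qed

lemma line_deriv_homogeneous:
  assumes "f \<in> homogeneous_space m"
  shows "line_deriv i f (partial_deriv i f)" and "partial_deriv i f \<in> homogeneous_space (m - 1)"
proof -
  have "\<exists>f'. line_deriv i f f' \<and> f' \<in> homogeneous_space (m - 1)"
    using assms unfolding homogeneous_space_def[of m]
  proof (induction rule: span_induct_alt)
    case base
    show ?case
      using line_deriv_zero subspace_0[OF subspace_homogeneous] by blast
  next
    case (step c g f)
    then obtain \<alpha> where \<alpha>: "g = monomial_fun \<alpha>" "sum \<alpha> UNIV = m" by blast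
    have "real (\<alpha> i) *\<^sub>R monomial_fun (\<alpha>(i := \<alpha> i - 1)) \<in> homogeneous_space (m - 1)"
    \<comment> \<open>For \<open>\<alpha> i = 0\<close> the altered exponent still has degree
      \<open>m\<close>; membership in degree \<open>m - 1\<close> holds only because the coefficient
      is zero.\<close>
    proof (cases "\<alpha> i = 0")
      case True
      then show ?thesis using subspace_0[OF subspace_homogeneous] by simp
    next
      case False
      have "sum (\<alpha>(i := \<alpha> i - 1)) UNIV = m - 1"
        using False \<alpha>(2) by (simp add: sum.remove[of UNIV i])
      then show ?thesis
        by (intro subspace_scale[OF subspace_homogeneous])
           (auto simp: homogeneous_space_def intro!: span_base)
    qed
    moreover have "line_deriv i g (real (\<alpha> i) *\<^sub>R monomial_fun (\<alpha>(i := \<alpha> i - 1)))"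
      using line_deriv_monomial[of i \<alpha>] by (simp add: \<alpha> scaleR_fun_def)
    moreover obtain f' where "line_deriv i f f'" "f' \<in> homogeneous_space (m - 1)"
      using step by blast
    ultimately show ?case
      using line_deriv_lincomb subspace_add[OF subspace_homogeneous]
        subspace_scale[OF subspace_homogeneous] by blast
  qed
  then obtain f' where "line_deriv i f f'" "f' \<in> homogeneous_space (m - 1)" by blast
  then show "line_deriv i f (partial_deriv i f)" "partial_deriv i f \<in> homogeneous_space (m - 1)"
    using line_deriv_partial_deriv by metis+
qed

lemma line_deriv_norm_squared: "line_deriv i (\<lambda>x. (norm x)\<^sup>2) (\<lambda>x. 2 * x $ i)"
  unfolding line_deriv_def norm_squared_eq
proof
  fix x :: "real ^ 'a"
  have "((\<lambda>t. \<Sum>j\<in>UNIV. (x + t *\<^sub>R axis i 1) $ j * (x + t *\<^sub>R axis i 1) $ j) has_real_derivative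
     (\<Sum>j\<in>UNIV. if j = i then 2 * x $ i else 0)) (at 0)"
    by (rule DERIV_sum) (auto simp: axis_def intro!: derivative_eq_intros)
  then show "((\<lambda>t. \<Sum>j\<in>UNIV. (x + t *\<^sub>R axis i 1) $ j * (x + t *\<^sub>R axis i 1) $ j) has_real_derivative
     2 * x $ i) (at 0)" by simp
qed

text \<open>Euler's identity: \<open>x $ i\<close> times the i-th derivative multiplies a monomial
  by its i-th exponent, and the exponents sum to \<open>m\<close>.\<close>

lemma euler_homogeneous:
  assumes "f \<in> homogeneous_space m"
  shows "(\<Sum>i\<in>UNIV. x $ i * partial_deriv i f x) = real m * f x"
proof -
  \<comment> \<open>Membership is carried through the induction because linearity of
    \<open>partial_deriv\<close> needs both summands differentiable.\<close>
  have "f \<in> homogeneous_space m \<and> (\<Sum>i\<in>UNIV. x $ i * partial_deriv i f x) = real m * f x"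
    if "f \<in> span {monomial_fun \<alpha> | \<alpha>. (\<Sum>i\<in>UNIV. \<alpha> i) = m}"
    using that
  proof (induction rule: span_induct_alt)
    case base
    show ?case using subspace_0[OF subspace_homogeneous[of m]] unfolding zero_fun_def
      by (simp add: partial_deriv_def)
  next
    case (step c g f)
    then obtain \<alpha> where \<alpha>: "g = monomial_fun \<alpha>" "sum \<alpha> UNIV = m" by blast
    have g: "x $ i * partial_deriv i g x = real (\<alpha> i) * g x" for i
    proof (cases "\<alpha> i")
      case (Suc k)
      have "monomial_fun \<alpha> x = (x $ i) * monomial_fun (\<alpha>(i := \<alpha> i - 1)) x"
        unfolding monomial_fun_def
        by (subst (1 2) prod.remove[of UNIV i]) (auto simp: Suc intro!: prod.cong)
      then show ?thesis
        by (simp add: \<alpha> line_deriv_partial_deriv[OF line_deriv_monomial])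
    qed (simp add: \<alpha> line_deriv_partial_deriv[OF line_deriv_monomial])
    have gh: "g \<in> homogeneous_space m" "f \<in> homogeneous_space m"
      using step by (auto simp: homogeneous_space_def intro: span_base)
    have "partial_deriv i (c *\<^sub>R g + f) x = c * partial_deriv i g x + partial_deriv i f x" for i
      by (subst line_deriv_partial_deriv[OF line_deriv_lincomb])
         (auto intro: line_deriv_homogeneous gh)
    then have "(\<Sum>i\<in>UNIV. x $ i * partial_deriv i (c *\<^sub>R g + f) x)
       = c * (\<Sum>i\<in>UNIV. x $ i * partial_deriv i g x) + (\<Sum>i\<in>UNIV. x $ i * partial_deriv i f x)"
      by (simp add: algebra_simps sum.distrib sum_distrib_left)
    also have "(\<Sum>i\<in>UNIV. x $ i * partial_deriv i g x) = real m * g x"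
      by (simp add: g \<alpha>(2)[symmetric] sum_distrib_right)
    finally show ?case using step gh
        subspace_add[OF subspace_homogeneous subspace_scale[OF subspace_homogeneous gh(1)] gh(2)]
      by (simp add: plus_fun_def scaleR_fun_def algebra_simps)
  qed
  with assms show ?thesis by (simp add: homogeneous_space_def)
qed

lemma laplacian_homogeneous:
  assumes "f \<in> homogeneous_space m"
  shows "laplacian f \<in> homogeneous_space (m - 2)"
proof -
  have "partial_deriv i (partial_deriv i f) \<in> homogeneous_space (m - 2)" for i
    using line_deriv_homogeneous(2)[OF line_deriv_homogeneous(2)[OF assms]]
    by (simp add: numeral_2_eq_2)
  then have "(\<Sum>i\<in>UNIV. partial_deriv i (partial_deriv i f)) \<in> homogeneous_space (m - 2)"
    by (intro subspace_sum[OF subspace_homogeneous])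
  also have "(\<Sum>i\<in>UNIV. partial_deriv i (partial_deriv i f)) = laplacian f"
    by (simp add: laplacian_def sum_fun_apply fun_eq_iff)
  finally show ?thesis .
qed

lemma laplacian_lincomb:
  assumes "f \<in> homogeneous_space m" and "g \<in> homogeneous_space m"
  shows "laplacian (c *\<^sub>R f + g) = c *\<^sub>R laplacian f + laplacian g"
proof -
  have "partial_deriv i (c *\<^sub>R f + g) = c *\<^sub>R partial_deriv i f + partial_deriv i g"
    if "f \<in> homogeneous_space m" "g \<in> homogeneous_space m" for i f g m
    using that by (intro line_deriv_partial_deriv line_deriv_lincomb line_deriv_homogeneous)
  then have "partial_deriv i (partial_deriv i (c *\<^sub>R f + g))
     = c *\<^sub>R partial_deriv i (partial_deriv i f) + partial_deriv i (partial_deriv i g)" for i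
    using assms line_deriv_homogeneous(2) by metis
  then show ?thesis
    by (simp add: laplacian_def fun_eq_iff sum.distrib sum_distrib_left)
qed

lemma laplacian_zero: "laplacian 0 = 0"
  by (simp add: laplacian_def fun_eq_iff line_deriv_partial_deriv[OF line_deriv_zero])

lemma laplacian_small_degree:
  assumes "f \<in> homogeneous_space m" and "m < 2"
  shows "laplacian f = 0"
proof -
  have const: "partial_deriv i g = 0" if "g \<in> homogeneous_space 0" for g :: "real ^ 'n::finite \<Rightarrow> real" and i
  proof -
    have "g (x + t *\<^sub>R axis i 1) = g 0" for x t
      using homogeneous_scale[OF that, of 0 "x + t *\<^sub>R axis i 1"] by simp
    then have "line_deriv i g 0" by (simp add: line_deriv_def)
    then show ?thesis by (rule line_deriv_partial_deriv)
  qed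
  have "partial_deriv i f \<in> homogeneous_space 0" for i
    using line_deriv_homogeneous(2)[OF assms(1), of i] assms(2) by simp
  then show ?thesis
    by (simp add: laplacian_def fun_eq_iff const)
qed

text \<open>Leibniz rule: \<open>2 * CARD('n)\<close> is the Laplacian of
  \<open>(norm x)\<^sup>2\<close>, and the mixed term is four times the Euler sum, that is
  \<open>4 * m * f x\<close>.\<close>

lemma laplacian_norm_squared_mult:
  fixes f :: "real ^ 'n::finite \<Rightarrow> real"
  assumes f: "f \<in> homogeneous_space m"
  shows "laplacian (\<lambda>x. (norm x)\<^sup>2 * f x) x
    = (2 * real CARD('n) + 4 * real m) * f x + (norm x)\<^sup>2 * laplacian f x"
proof -
  have d1: "line_deriv i (\<lambda>x. (norm x)\<^sup>2 * f x) (\<lambda>x. 2 * x $ i * f x + (norm x)\<^sup>2 * partial_deriv i f x)" for i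
    by (intro line_deriv_mult line_deriv_norm_squared line_deriv_homogeneous(1)[OF f])
  have d2: "line_deriv i (\<lambda>x. 2 * x $ i) (\<lambda>x. 2)" for i :: 'n
    by (auto simp: line_deriv_def axis_def intro!: derivative_eq_intros)
  have "partial_deriv i (partial_deriv i (\<lambda>x. (norm x)\<^sup>2 * f x)) =
     (\<lambda>x. (2 * f x + 2 * x $ i * partial_deriv i f x)
        + (2 * x $ i * partial_deriv i f x + (norm x)\<^sup>2 * partial_deriv i (partial_deriv i f) x))" for i
    unfolding line_deriv_partial_deriv[OF d1]
    by (intro line_deriv_partial_deriv line_deriv_add line_deriv_mult d2
        line_deriv_norm_squared line_deriv_homogeneous(1)[OF f]
        line_deriv_homogeneous(1)[OF line_deriv_homogeneous(2)[OF f]])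
  then have "laplacian (\<lambda>x. (norm x)\<^sup>2 * f x) x =
     (\<Sum>i\<in>UNIV. 2 * f x + 4 * (x $ i * partial_deriv i f x)
       + (norm x)\<^sup>2 * partial_deriv i (partial_deriv i f) x)"
    by (simp add: laplacian_def algebra_simps)
  also have "\<dots> = 2 * real CARD('n) * f x + 4 * (\<Sum>i\<in>UNIV. x $ i * partial_deriv i f x)
     + (norm x)\<^sup>2 * laplacian f x"
    by (simp add: sum.distrib laplacian_def sum_distrib_left)
  finally show ?thesis
    by (simp add: euler_homogeneous[OF f] algebra_simps)
qed

text \<open>Each further factor \<open>(norm x)\<^sup>2\<close> adds a positive amount to the
  constant. Only its positivity matters later, since \<open>harmonic_decomposition\<close> divides
  by it.\<close>

lemma laplacian_norm_power_mult_harmonic: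
  assumes "Y \<in> harmonic_space k"
  shows "\<exists>c>0. laplacian (\<lambda>x. ((norm x)\<^sup>2) ^ Suc j * Y x) = (\<lambda>x. c * (((norm x)\<^sup>2) ^ j * Y x))"
proof (induction j)
  case 0
  have "Y \<in> homogeneous_space k" "laplacian Y = 0"
    using assms by (auto simp: harmonic_space_def)
  then show ?case
    by (intro exI[of _ "2 * real CARD('a) + 4 * real k"])
       (auto simp: laplacian_norm_squared_mult fun_eq_iff intro!: add_pos_nonneg)
next
  case (Suc j)
  then obtain c where c: "c > 0"
    "laplacian (\<lambda>x. ((norm x)\<^sup>2) ^ Suc j * Y x) = (\<lambda>x. c * (((norm x)\<^sup>2) ^ j * Y x))" by blast
  have "Y \<in> homogeneous_space k"
    using assms by (auto simp: harmonic_space_def)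
  from laplacian_norm_squared_mult[OF norm_power_mult_homogeneous[OF this, of "Suc j"]]
  have "laplacian (\<lambda>x. ((norm x)\<^sup>2) ^ Suc (Suc j) * Y x)
     = (\<lambda>x. (2 * real CARD('a) + 4 * real (2 * Suc j + k) + c) * (((norm x)\<^sup>2) ^ Suc j * Y x))"
    unfolding c(2) by (simp add: fun_eq_iff algebra_simps)
  moreover have "2 * real CARD('a) + 4 * real (2 * Suc j + k) + c > 0"
    using c by (intro add_nonneg_pos) auto
  ultimately show ?case by blast
qed

text \<open>
  On the span of the products \<open>(norm x)\<^sup>2 ^ j * Y x\<close> with harmonic \<open>Y\<close> the Laplacian composed with
  multiplication by \<open>(norm x)\<^sup>2\<close> is diagonal with positive eigenvalues; subtracting the
  preimage of \<open>laplacian f\<close> leaves a harmonic polynomial.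
\<close>

theorem harmonic_decomposition:
  assumes "f \<in> homogeneous_space m"
  shows "f \<in> span {\<lambda>x. ((norm x)\<^sup>2) ^ j * Y x | j k Y. Y \<in> harmonic_space k \<and> 2 * j + k = m}"
  using assms
proof (induction m arbitrary: f rule: less_induct)
  case (less m)
  let ?D = "\<lambda>m. {\<lambda>x. ((norm x)\<^sup>2) ^ j * Y x | j k Y.
      Y \<in> harmonic_space k \<and> 2 * j + k = m} :: (real ^ 'a \<Rightarrow> real) set"
  have harm: "h \<in> span (?D m)" if "h \<in> harmonic_space m" for h
    using that by (intro span_base) (force intro: exI[of _ 0])
  show ?case
  \<comment> \<open>In degrees 0 and 1 the subtraction \<open>m - 2\<close> truncates and the
    induction could not descend, but there every polynomial is harmonic.\<close>
  proof (cases "m < 2")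
    case True
    with less.prems have "f \<in> harmonic_space m"
      by (auto simp: harmonic_space_def laplacian_small_degree)
    then show ?thesis by (rule harm)
  next
    case False
    have hom: "span (?D m) \<subseteq> homogeneous_space m"
      by (rule span_minimal[OF _ subspace_homogeneous])
         (auto simp: harmonic_space_def norm_power_mult_homogeneous)
    have inv: "\<exists>g \<in> span (?D m). laplacian g = u" if "u \<in> span (?D (m - 2))" for u
      using that
    proof (induction rule: span_induct_alt)
      case base
      show ?case using laplacian_zero span_0 by blast
    next
      case (step a v u)
      then obtain g where g: "g \<in> span (?D m)" "laplacian g = u" by blast
      obtain j k Y where Y: "v = (\<lambda>x. ((norm x)\<^sup>2) ^ j * Y x)" "Y \<in> harmonic_space k" "2 * j + k = m - 2"
        using step(1) by blast
      obtain c where c: "c > 0" "laplacian (\<lambda>x. ((norm x)\<^sup>2) ^ Suc j * Y x) = c *\<^sub>R v"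
        using laplacian_norm_power_mult_harmonic[OF Y(2)] by (force simp: Y(1) scaleR_fun_def)
      let ?h = "\<lambda>x. ((norm x)\<^sup>2) ^ Suc j * Y x"
      have "2 * Suc j + k = m" using False Y(3) by simp
      with Y(2) have h: "?h \<in> span (?D m)" by (intro span_base) blast
      have "laplacian ((a / c) *\<^sub>R ?h + g) = a *\<^sub>R v + u"
        using c by (subst laplacian_lincomb[of _ m]) (use g h hom in auto)
      moreover have "(a / c) *\<^sub>R ?h + g \<in> span (?D m)"
        by (intro span_add span_scale g h)
      ultimately show ?case by blast
    qed
    have "laplacian f \<in> span (?D (m - 2))"
      using False by (intro less.IH laplacian_homogeneous less.prems) auto
    then obtain g where g: "g \<in> span (?D m)" "laplacian g = laplacian f"
      using inv by blast
    have "laplacian ((-1) *\<^sub>R g + f) = 0"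
      using g hom less.prems by (subst laplacian_lincomb[of _ m]) auto
    moreover have "(-1) *\<^sub>R g + f \<in> homogeneous_space m"
      by (intro subspace_add subspace_scale subspace_homogeneous) (use g hom less.prems in auto)
    ultimately have "(-1) *\<^sub>R g + f \<in> harmonic_space m"
      by (auto simp: harmonic_space_def)
    from span_add[OF harm[OF this] g(1)] show ?thesis by simp
  qed
qed

section \<open>Polar coordinates\<close>

lemma (in pair_sigma_finite)
  fixes f :: "'a \<Rightarrow> real" and g :: "'b \<Rightarrow> real"
  assumes f: "integrable M1 f" and g: "integrable M2 g"
  shows integrable_fst_times_snd: "integrable (M1 \<Otimes>\<^sub>M M2) (\<lambda>(x, y). f x * g y)"
    and integral_fst_times_snd:
      "(\<integral>(x, y). f x * g y \<partial>(M1 \<Otimes>\<^sub>M M2)) = integral\<^sup>L M1 f * integral\<^sup>L M2 g"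
proof -
  note [measurable] = borel_measurable_integrable[OF f] borel_measurable_integrable[OF g]
  show int: "integrable (M1 \<Otimes>\<^sub>M M2) (\<lambda>(x, y). f x * g y)"
    by (rule Fubini_integrable) (auto simp: abs_mult intro!: integrable_mult_left integrable_mult_right f g integrable_abs)
  show "(\<integral>(x, y). f x * g y \<partial>(M1 \<Otimes>\<^sub>M M2)) = integral\<^sup>L M1 f * integral\<^sup>L M2 g"
    using integral_fst[OF int] by simp
qed

lemma emeasure_sphere_surface_finite:
  "emeasure (sphere_surface :: (real ^ 'n::finite) measure) (space sphere_surface) < \<infinity>"
proof -
  let ?C = "{r *\<^sub>R \<xi> | r \<xi>. 0 < r \<and> r \<le> 1 \<and> \<xi> \<in> sphere 0 1} :: (real ^ 'n) set"
  have "emeasure lborel ?C \<le> emeasure lborel (cball 0 1 :: (real ^ 'n) set)"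
    by (rule emeasure_mono) auto
  also have "\<dots> < \<infinity>" by (simp add: emeasure_cball)
  finally show ?thesis
    by (simp add: emeasure_sphere_surface ennreal_mult_less_top ennreal_of_nat_eq_real_of_nat)
qed

lemma finite_measure_sphere_surface:
  "finite_measure (sphere_surface :: (real ^ 'n::finite) measure)"
  using emeasure_sphere_surface_finite[where 'n = 'n] by (intro finite_measureI) auto

section \<open>Lebesgue measure as the product of a radial measure and the surface measure\<close>

lemma emeasure_lborel_scale:
  fixes A :: "(real ^ 'n::finite) set"
  assumes A: "A \<in> sets borel" and c: "c > 0"
  shows "emeasure lborel ((\<lambda>x. c *\<^sub>R x) -` A) * ennreal (c ^ CARD('n)) = emeasure lborel A"
proof -
  have "emeasure lborel A = emeasure (density (distr lborel borel (\<lambda>x. 0 + c *\<^sub>R x)) (\<lambda>_. \<bar>c\<bar> ^ DIM(real ^ 'n))) A"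
    using lborel_affine[of c "0 :: real ^ 'n"] c by simp
  also have "\<dots> = ennreal (c ^ CARD('n)) * emeasure lborel ((\<lambda>x. c *\<^sub>R x) -` A)"
    using A c by (subst emeasure_density) (auto simp: nn_integral_cmult emeasure_distr)
  finally show ?thesis by (simp add: mult.commute)
qed

text \<open>The radial factor of Lebesgue measure in dimension \<open>d\<close>. The mass
  \<open>a ^ d / d\<close> of a ball of radius \<open>a\<close> matches the factor \<open>d\<close>
  in the surface measure, so no constant appears in polar coordinates. The indicator removes
  negative radii, where an even power would be positive.\<close>

definition radial_measure :: "nat \<Rightarrow> real measure" where
  "radial_measure d = density lborel (\<lambda>r. ennreal (indicator {0<..} r * r ^ (d - 1)))"

lemma sets_radial_measure [simp, measurable_cong]: "sets (radial_measure d) = sets borel"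
  by (simp add: radial_measure_def)

lemma space_radial_measure [simp]: "space (radial_measure d) = UNIV"
  by (simp add: radial_measure_def)

lemma emeasure_radial_measure_atMost:
  assumes "0 \<le> a" and "d > 0"
  shows "emeasure (radial_measure d) {..a} = ennreal (a ^ d / d)"
proof -
  have "emeasure (radial_measure d) {..a}
      = (\<integral>\<^sup>+ r. ennreal (indicator {0<..} r * r ^ (d - 1)) * indicator {..a} r \<partial>lborel)"
    unfolding radial_measure_def by (subst emeasure_density) auto
  also have "\<dots> = (\<integral>\<^sup>+ r. ennreal (r ^ (d - 1)) * indicator {0..a} r \<partial>lborel)"
  proof (intro nn_integral_cong_AE)
    \<comment> \<open>For \<open>d = 1\<close> the two integrands really differ at
      \<open>r = 0\<close>, because \<open>0 ^ 0 = 1\<close>.\<close>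
    have "AE r :: real in lborel. r \<noteq> 0" by (rule AE_lborel_singleton)
    then show "AE r in lborel. ennreal (indicator {0<..} r * r ^ (d - 1)) * indicator {..a} r
      = ennreal (r ^ (d - 1)) * indicator {0..a} r"
      by eventually_elim (auto split: split_indicator)
  qed
  also have "\<dots> = ennreal (a ^ d / d - 0 ^ d / d)"
  proof (rule nn_integral_FTC_Icc)
    show "((\<lambda>r. r ^ d / d) has_real_derivative r ^ (d - 1)) (at r)" for r :: real
      using \<open>d > 0\<close> by (auto intro!: derivative_eq_intros)
  qed (use assms in auto)
  finally show ?thesis using assms by (simp add: zero_power)
qed

lemma measure_eqI_atMost:
  fixes M N :: "real measure"
  assumes sets: "sets M = sets borel" "sets N = sets borel"
    and fin: "\<And>x. emeasure M {..x} < \<infinity>"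
    and eq: "\<And>x. emeasure M {..x} = emeasure N {..x}"
  shows "M = N"
proof (rule measure_eqI_generator_eq[where A = "\<lambda>n::nat. {..real n}" and E = "range (\<lambda>a::real. {..a})" and \<Omega> = UNIV])
  show "Int_stable (range (\<lambda>a::real. {..a}))"
    by (auto simp: Int_stable_def)
  show "(\<Union>n::nat. {..real n}) = UNIV"
    by (auto intro: real_arch_simple)
  show "sets M = sigma_sets UNIV (range (\<lambda>a::real. {..a}))"
       "sets N = sigma_sets UNIV (range (\<lambda>a::real. {..a}))"
    unfolding sets borel_eq_atMost by auto
qed (use fin eq in \<open>auto simp: less_top\<close>)

lemma cone_eq:
  fixes A :: "(real ^ 'n::finite) set"
  assumes "A \<subseteq> sphere 0 1"
  shows "{r *\<^sub>R \<xi> | r \<xi>. 0 < r \<and> r \<le> 1 \<and> \<xi> \<in> A} = {x. x \<noteq> 0 \<and> norm x \<le> 1 \<and> sgn x \<in> A}"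
proof (intro equalityI subsetI)
  fix x assume x: "x \<in> {x. x \<noteq> 0 \<and> norm x \<le> 1 \<and> sgn x \<in> A}"
  then show "x \<in> {r *\<^sub>R \<xi> | r \<xi>. 0 < r \<and> r \<le> 1 \<and> \<xi> \<in> A}"
    by (intro CollectI exI[of _ "norm x"] exI[of _ "sgn x"]) (auto simp: sgn_div_norm)
next
  fix x assume "x \<in> {r *\<^sub>R \<xi> | r \<xi>. 0 < r \<and> r \<le> 1 \<and> \<xi> \<in> A}"
  then obtain r \<xi> where r: "x = r *\<^sub>R \<xi>" "0 < r" "r \<le> 1" "\<xi> \<in> A" by blast
  then have "norm \<xi> = 1" using assms by auto
  then show "x \<in> {x. x \<noteq> 0 \<and> norm x \<le> 1 \<and> sgn x \<in> A}"
    using r by (auto simp: sgn_div_norm)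
qed

lemma sgn_measurable [measurable]: "(sgn :: real ^ 'n::finite \<Rightarrow> real ^ 'n) \<in> borel_measurable borel"
  unfolding sgn_div_norm by measurable

text \<open>For fixed \<open>A\<close> both sides are measures in \<open>B\<close>, so half-lines
  suffice. The sector of radius \<open>a\<close> is the unit cone over \<open>A\<close> dilated by
  \<open>a\<close>, and the volume of that cone is what defines the surface measure of
  \<open>A\<close>.\<close>

lemma emeasure_radial_sector:
  fixes A :: "(real ^ 'n::finite) set"
  assumes A: "A \<in> sets borel" "A \<subseteq> sphere 0 1" and B: "B \<in> sets borel"
  shows "emeasure lborel {x. norm x \<in> B \<and> x \<noteq> 0 \<and> sgn x \<in> A}
    = emeasure (radial_measure CARD('n)) B * emeasure sphere_surface A"
proof -
  define M where "M = distr (restrict_space lborel {x. x \<noteq> 0 \<and> sgn x \<in> A}) borel (norm :: real ^ 'n \<Rightarrow> real)"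
  define N where "N = scale_measure (emeasure sphere_surface A) (radial_measure CARD('n))"
  let ?S = "{x. x \<noteq> 0 \<and> sgn x \<in> A}"
  note [measurable] = A(1)
  have S[measurable]: "?S \<in> sets borel" by measurable
  have M: "emeasure M B = emeasure lborel {x. norm x \<in> B \<and> x \<in> ?S}" if "B \<in> sets borel" for B
  proof -
    note [measurable] = that
    have "emeasure M B = emeasure (restrict_space lborel ?S) (norm -` B \<inter> ?S)"
      unfolding M_def using S that
      by (subst emeasure_distr) (auto intro!: measurable_restrict_space1 simp: space_restrict_space)
    also have "\<dots> = emeasure lborel (norm -` B \<inter> ?S)"
      by (rule emeasure_restrict_space) (use S in auto)
    also have "norm -` B \<inter> ?S = {x. norm x \<in> B \<and> x \<in> ?S}" by auto
    finally show ?thesis .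
  qed
  define \<sigma> where "\<sigma> = emeasure sphere_surface A"
  have \<sigma>1: "\<sigma> = of_nat CARD('n) * emeasure lborel {x. norm x \<le> 1 \<and> x \<in> ?S}"
    unfolding \<sigma>_def emeasure_sphere_surface[OF A] cone_eq[OF A(2)] by (simp add: conj_ac)
  have \<sigma>_fin: "\<sigma> < \<infinity>"
    unfolding \<sigma>_def
    using emeasure_sphere_surface_finite[where 'n = 'n] emeasure_space[of sphere_surface A]
    by (auto simp: less_top top_unique)
  have Nx: "emeasure N {..a} = ennreal (a ^ CARD('n) / CARD('n)) * \<sigma>" if "a \<ge> 0" for a
    using that by (simp add: N_def \<sigma>_def emeasure_radial_measure_atMost mult.commute)
  have eq: "emeasure M {..a} = emeasure N {..a}" for a
  proof (cases "a > 0")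
    case False
    then have "{x. norm x \<in> {..a} \<and> x \<in> ?S} = {}"
      by (auto simp: not_less) (metis norm_le_zero_iff order_trans)
    then have "emeasure M {..a} = emeasure lborel ({} :: (real ^ 'n) set)"
      unfolding M[OF atMost_borel] by (rule arg_cong)
    moreover have "emeasure N {..a} = 0"
    proof -
      have "emeasure N {..a} \<le> emeasure N {..0}"
        using False by (intro emeasure_mono) (auto simp: N_def)
      also have "\<dots> = 0" by (subst Nx) auto
      finally show ?thesis by simp
    qed
    ultimately show ?thesis by simp
  next
    case True
    have "(\<lambda>x. a *\<^sub>R x) -` {x. norm x \<in> {..a} \<and> x \<in> ?S} = {x. norm x \<le> 1 \<and> x \<in> ?S}"
      using True by (auto simp: sgn_scaleR)
    then have "emeasure lborel {x. norm x \<in> {..a} \<and> x \<in> ?S}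
      = emeasure lborel {x. norm x \<le> 1 \<and> x \<in> ?S} * ennreal (a ^ CARD('n))"
      using emeasure_lborel_scale[of "{x. norm x \<in> {..a} \<and> x \<in> ?S}" a] True by simp
    also have "\<dots> = ennreal (a ^ CARD('n) / CARD('n)) * \<sigma>"
    proof -
      have "ennreal (a ^ CARD('n) / CARD('n)) * of_nat CARD('n) = ennreal (a ^ CARD('n))"
        using True unfolding ennreal_of_nat_eq_real_of_nat by (subst ennreal_mult[symmetric]) auto
      then show ?thesis unfolding \<sigma>1 by (simp only: mult.assoc[symmetric]) (simp add: mult.commute)
    qed
    finally show ?thesis using True by (simp add: M Nx)
  qed
  have "M = N"
  proof (rule measure_eqI_atMost)
    show "emeasure M {..a} < \<infinity>" for a
    proof -
      have "emeasure M {..a} \<le> emeasure M {..max a 0}"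
        by (intro emeasure_mono) (auto simp: M_def)
      also have "\<dots> < \<infinity>" unfolding eq using \<sigma>_fin by (subst Nx) (auto simp: ennreal_mult_less_top)
      finally show ?thesis .
    qed
  qed (simp_all add: M_def N_def eq[unfolded M_def N_def])
  then have "emeasure M B = emeasure N B" by simp
  then show ?thesis using B by (simp add: M) (simp add: N_def mult.commute)
qed

lemma sigma_finite_radial_measure: "sigma_finite_measure (radial_measure d)"
  unfolding radial_measure_def
  by (subst sigma_finite_measure.sigma_finite_iff_density_finite[OF sigma_finite_lborel]) auto

text \<open>With \<sigma>-finite factors the product measure is determined by rectangles, and the
  preimage of a rectangle is a sector as in \<open>emeasure_radial_sector\<close>. The origin is cut
  out because its \<open>sgn\<close> is not on the sphere.\<close>

lemma polar_measure_eq: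
  "radial_measure CARD('n) \<Otimes>\<^sub>M (sphere_surface :: (real ^ 'n::finite) measure) =
    distr (restrict_space lborel (- {0 :: real ^ 'n})) (borel \<Otimes>\<^sub>M restrict_space borel (sphere 0 1))
      (\<lambda>x. (norm x, sgn x))" (is "_ = ?D")
proof (rule pair_measure_eqI)
  have m: "(\<lambda>x. (norm x, sgn x)) \<in> restrict_space lborel (- {0 :: real ^ 'n}) \<rightarrow>\<^sub>M borel \<Otimes>\<^sub>M restrict_space borel (sphere 0 1)"
    by (intro measurable_Pair measurable_restrict_space2 measurable_restrict_space1)
       (auto simp: space_restrict_space norm_sgn)
  show "sigma_finite_measure (radial_measure CARD('n))" by (rule sigma_finite_radial_measure)
  show "sigma_finite_measure (sphere_surface :: (real ^ 'n) measure)"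
    using finite_measure_sphere_surface by (rule finite_measure.axioms)
  show "sets (radial_measure CARD('n) \<Otimes>\<^sub>M (sphere_surface :: (real ^ 'n) measure)) = sets ?D"
    by (simp cong: sets_pair_measure_cong)
  fix B A
  assume B: "B \<in> sets (radial_measure CARD('n))" and A: "A \<in> sets (sphere_surface :: (real ^ 'n) measure)"
  have A': "A \<in> sets borel" "A \<subseteq> sphere 0 1"
    using A by (auto simp: sets_restrict_space_iff)
  note [measurable] = A'(1)
  have "emeasure ?D (B \<times> A) = emeasure (restrict_space lborel (- {0 :: real ^ 'n}))
      ((\<lambda>x. (norm x, sgn x)) -` (B \<times> A) \<inter> (- {0}))"
    using A B by (subst emeasure_distr[OF m]) (auto simp: space_restrict_space)
  also have "\<dots> = emeasure lborel ((\<lambda>x. (norm x, sgn x)) -` (B \<times> A) \<inter> (- {0}))"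
    by (rule emeasure_restrict_space) auto
  also have "(\<lambda>x. (norm x, sgn x)) -` (B \<times> A) \<inter> (- {0}) = {x. norm x \<in> B \<and> x \<noteq> 0 \<and> sgn x \<in> A}" by auto
  also have "emeasure lborel \<dots> = emeasure (radial_measure CARD('n)) B * emeasure sphere_surface A"
    using A' B by (intro emeasure_radial_sector) auto
  finally show "emeasure (radial_measure CARD('n)) B * emeasure sphere_surface A = emeasure ?D (B \<times> A)" ..
qed

text \<open>The value at the origin is irrelevant: \<open>sgn 0 = 0\<close> is not on the sphere, but \<open>{0}\<close> is a null set.\<close>

lemma polar_integral:
  fixes F :: "real \<Rightarrow> real" and G :: "real ^ 'n::finite \<Rightarrow> real"
  assumes F: "integrable (radial_measure CARD('n)) F" and G: "integrable sphere_surface G"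
    and h: "h \<in> borel_measurable borel" "\<And>x. x \<noteq> 0 \<Longrightarrow> h x = F (norm x) * G (sgn x)"
  shows "integrable lborel h"
    and "integral\<^sup>L lborel h = integral\<^sup>L (radial_measure CARD('n)) F * integral\<^sup>L sphere_surface G"
proof -
  interpret R: sigma_finite_measure "radial_measure CARD('n)" by (rule sigma_finite_radial_measure)
  interpret S: finite_measure "sphere_surface :: (real ^ 'n) measure" by (rule finite_measure_sphere_surface)
  interpret RS: pair_sigma_finite "radial_measure CARD('n)" "sphere_surface :: (real ^ 'n) measure" ..
  let ?R = "restrict_space lborel (- {0 :: real ^ 'n})"
  let ?P = "borel \<Otimes>\<^sub>M restrict_space borel (sphere 0 1) :: (real \<times> (real ^ 'n)) measure"
  have m: "(\<lambda>x. (norm x, sgn x)) \<in> ?R \<rightarrow>\<^sub>M ?P"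
    by (intro measurable_Pair measurable_restrict_space2 measurable_restrict_space1)
       (auto simp: space_restrict_space norm_sgn)
  have FG: "(\<lambda>(r, y). F r * G y) \<in> borel_measurable ?P"
    using borel_measurable_integrable[OF RS.integrable_fst_times_snd[OF F G]]
    by (simp cong: measurable_cong_sets sets_pair_measure_cong)
  have nz: "AE x :: real ^ 'n in lborel. x \<noteq> 0"
    by (rule AE_lborel_singleton)
  have hR: "integrable ?R (\<lambda>x. F (norm x) * G (sgn x))"
    using RS.integrable_fst_times_snd[OF F G]
    unfolding polar_measure_eq integrable_distr_eq[OF m FG] by simp
  have hRi: "integral\<^sup>L ?R (\<lambda>x. F (norm x) * G (sgn x)) =
      integral\<^sup>L (radial_measure CARD('n)) F * integral\<^sup>L sphere_surface G"
    using RS.integral_fst_times_snd[OF F G]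
    unfolding polar_measure_eq integral_distr[OF m FG] by simp
  have i1: "integrable ?R h"
    using hR
    by (subst Bochner_Integration.integrable_cong[OF refl, of ?R h "\<lambda>x. F (norm x) * G (sgn x)"])
       (simp_all add: space_restrict_space h(2))
  have i2: "integral\<^sup>L ?R h = integral\<^sup>L ?R (\<lambda>x. F (norm x) * G (sgn x))"
    by (rule Bochner_Integration.integral_cong) (auto simp: space_restrict_space h(2))
  have ae: "AE x in lborel. indicator (- {0}) x *\<^sub>R h x = h x"
    using nz by eventually_elim auto
  have hm: "h \<in> borel_measurable lborel" "(\<lambda>x. indicator (- {0}) x *\<^sub>R h x) \<in> borel_measurable lborel"
    using h(1) by measurable
  show "integrable lborel h"
    using i1 integrable_cong_AE[OF hm(2,1) ae] by (simp add: integrable_restrict_space)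
  show "integral\<^sup>L lborel h = integral\<^sup>L (radial_measure CARD('n)) F * integral\<^sup>L sphere_surface G"
    using i2 hRi integral_cong_AE[OF hm(2,1) ae] by (simp add: integral_restrict_space)
qed

lemma integrable_radial_measure_iff:
  fixes F :: "real \<Rightarrow> real"
  assumes "F \<in> borel_measurable borel"
  shows "integrable (radial_measure d) F \<longleftrightarrow> integrable lborel (\<lambda>r. indicator {0<..} r * r ^ (d - 1) * F r)"
    and "integral\<^sup>L (radial_measure d) F = (\<integral>r. indicator {0<..} r * r ^ (d - 1) * F r \<partial>lborel)"
  using assms unfolding radial_measure_def
  by (subst integrable_real_density integral_real_density; auto split: split_indicator)+

section \<open>Orthogonality of harmonic polynomials\<close>

text \<open>Fubini in coordinates: \<open>lborel\<close> is the image of a product measure indexed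
  by the basis vectors, and \<open>axis i 1\<close> identifies these with the indices
  \<open>i\<close>.\<close>

lemma
  fixes h :: "'n::finite \<Rightarrow> real \<Rightarrow> real"
  assumes h: "\<And>i. integrable lborel (h i)"
  shows integrable_lborel_vec_prod: "integrable lborel (\<lambda>x :: real ^ 'n. \<Prod>i\<in>UNIV. h i (x $ i))"
    and integral_lborel_vec_prod:
      "(\<integral>(x :: real ^ 'n). (\<Prod>i\<in>UNIV. h i (x $ i)) \<partial>lborel) = (\<Prod>i\<in>UNIV. integral\<^sup>L lborel (h i))"
proof -
  interpret product_sigma_finite "\<lambda>_ :: real ^ 'n. lborel :: real measure" ..
  note [measurable] = borel_measurable_integrable[OF h]
  let ?B = "Basis :: (real ^ 'n) set"
  let ?v = "\<lambda>f. \<Sum>b\<in>?B. f b *\<^sub>R b"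
  have B: "?B = (\<lambda>i. axis i 1) ` UNIV" by (auto simp: Basis_vec_def)
  have inj: "inj_on (\<lambda>i :: 'n. axis i (1 :: real)) UNIV" by (auto simp: inj_on_def axis_eq_axis)
  have comp: "?v f $ i = f (axis i 1)" for f :: "real ^ 'n \<Rightarrow> real" and i
    unfolding B sum.reindex[OF inj] by (simp add: axis_def if_distrib cong: if_cong)
  have reindex: "(\<Prod>i\<in>UNIV. g i (axis i 1)) = (\<Prod>b\<in>?B. g (axis_index b) b)" for g :: "'n \<Rightarrow> real ^ 'n \<Rightarrow> real"
    unfolding B prod.reindex[OF inj] by (simp add: axis_index_axis)
  have eq: "(\<Prod>i\<in>UNIV. h i (?v f $ i)) = (\<Prod>b\<in>?B. h (axis_index b) (f b))" for f
    unfolding comp using reindex[of "\<lambda>i b. h i (f b)"] .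
  have m: "?v \<in> (\<Pi>\<^sub>M b\<in>?B. lborel) \<rightarrow>\<^sub>M borel" by measurable
  have h': "(\<lambda>x :: real ^ 'n. \<Prod>i\<in>UNIV. h i (x $ i)) \<in> borel_measurable borel" by measurable
  have int: "integrable (\<Pi>\<^sub>M b\<in>?B. lborel) (\<lambda>f. \<Prod>b\<in>?B. h (axis_index b) (f b))"
    by (intro product_integrable_prod h) auto
  have int_eq: "(\<integral>f. (\<Prod>b\<in>?B. h (axis_index b) (f b)) \<partial>(\<Pi>\<^sub>M b\<in>?B. lborel))
      = (\<Prod>b\<in>?B. integral\<^sup>L lborel (h (axis_index b)))"
    by (intro product_integral_prod h) auto
  show "integrable lborel (\<lambda>x :: real ^ 'n. \<Prod>i\<in>UNIV. h i (x $ i))"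
    by (subst lborel_eq, subst integrable_distr_eq[OF m h']) (use int in \<open>simp only: eq\<close>)
  show "(\<integral>(x :: real ^ 'n). (\<Prod>i\<in>UNIV. h i (x $ i)) \<partial>lborel) = (\<Prod>i\<in>UNIV. integral\<^sup>L lborel (h i))"
    by (subst lborel_eq, subst integral_distr[OF m h'])
       (simp only: eq int_eq reindex[of "\<lambda>i b. integral\<^sup>L lborel (h i)"])
qed

section \<open>Integration by parts against the Gaussian weight\<close>

lemma gaussian_moment_even:
  "has_bochner_integral lborel (\<lambda>x::real. x ^ (2 * k) * exp (- x\<^sup>2)) (sqrt pi * (fact (2 * k) / (2 ^ (2 * k) * fact k)))"
  using has_bochner_integral_even_function[OF gaussian_moment_even_pos[of k]]
  by (simp add: mult.commute)

lemma gaussian_moment_odd: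
  "has_bochner_integral lborel (\<lambda>x::real. x ^ (2 * k + 1) * exp (- x\<^sup>2)) 0"
  using has_bochner_integral_odd_function[OF gaussian_moment_odd_pos[of k]]
  by (simp add: mult.commute)

lemma integrable_gaussian_moment: "integrable lborel (\<lambda>x::real. x ^ k * exp (- x\<^sup>2))"
proof (cases "even k")
  case True
  then show ?thesis using gaussian_moment_even by (auto elim!: evenE intro: integrable.intros)
next
  case False
  then obtain a where "k = 2 * a + 1" by (elim oddE)
  then show ?thesis using gaussian_moment_odd[of a] by (auto intro: integrable.intros)
qed

text \<open>This expresses that the derivative of \<open>x ^ k * exp (- x\<^sup>2)\<close> has
  integral zero. It is read off the known moments: for even \<open>k\<close> by parity, for odd
  \<open>k\<close> from the ratio of consecutive even moments.\<close>

lemma gaussian_moment_parts: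
  "2 * (\<integral>(x::real). x ^ (k + 1) * exp (- x\<^sup>2) \<partial>lborel) = real k * (\<integral>(x::real). x ^ (k - 1) * exp (- x\<^sup>2) \<partial>lborel)"
proof (cases "even k")
  case True
  then obtain a where a: "k = 2 * a" by (elim evenE)
  show ?thesis
  proof (cases a)
    \<comment> \<open>Here \<open>k - 1\<close> truncates to 0 and that moment is nonzero; the
      factor \<open>real k = 0\<close> saves the identity.\<close>
    case 0
    then show ?thesis using a has_bochner_integral_integral_eq[OF gaussian_moment_odd[of 0]] by simp
  next
    case (Suc b)
    then show ?thesis
      using a has_bochner_integral_integral_eq[OF gaussian_moment_odd[of a]]
        has_bochner_integral_integral_eq[OF gaussian_moment_odd[of b]] by simp
  qed
next
  case False
  then obtain a where a: "k = 2 * a + 1" by (elim oddE)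
  have "2 * (fact (2 * Suc a) / (2 ^ (2 * Suc a) * fact (Suc a)))
      = (2 * real a + 1) * (fact (2 * a) / (2 ^ (2 * a) * fact a) :: real)"
    by (simp add: divide_simps)
  then have "2 * (sqrt pi * (fact (2 * Suc a) / (2 ^ (2 * Suc a) * fact (Suc a))))
      = (2 * real a + 1) * (sqrt pi * (fact (2 * a) / (2 ^ (2 * a) * fact a) :: real))"
    by (simp only: mult.left_commute[of _ "sqrt pi"])
  then show ?thesis
    using has_bochner_integral_integral_eq[OF gaussian_moment_even[of "Suc a"]]
      has_bochner_integral_integral_eq[OF gaussian_moment_even[of a]]
    by (simp add: a)
qed

text \<open>Positivity allows this factor to be cancelled when a spherical integral is recovered
  from a Gaussian one.\<close>

lemma gaussian_radial_moment:
  "integrable (radial_measure d) (\<lambda>r. r ^ m * exp (- r\<^sup>2))"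
  "integral\<^sup>L (radial_measure d) (\<lambda>r. r ^ m * exp (- r\<^sup>2)) > 0"
proof -
  obtain c :: real where c: "c > 0"
    "has_bochner_integral lborel (\<lambda>x. indicator {0..} x *\<^sub>R (exp (- x\<^sup>2) * x ^ (d - 1 + m))) c"
  proof (cases "even (d - 1 + m)")
    case True
    then obtain k where k: "d - 1 + m = 2 * k" by (elim evenE)
    show ?thesis
      by (rule that[OF _ gaussian_moment_even_pos[of k, folded k]]) simp
  next
    case False
    then obtain k where k: "d - 1 + m = 2 * k + 1" by (elim oddE)
    show ?thesis
      by (rule that[OF _ gaussian_moment_odd_pos[of k, folded k]]) simp
  qed
  have ae: "AE r :: real in lborel. indicator {0..} r *\<^sub>R (exp (- r\<^sup>2) * r ^ (d - 1 + m))
      = indicator {0<..} r * r ^ (d - 1) * (r ^ m * exp (- r\<^sup>2))"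
    using AE_lborel_singleton[of "0::real"]
    by eventually_elim (auto simp: power_add split: split_indicator)
  have "has_bochner_integral lborel (\<lambda>r. indicator {0<..} r * r ^ (d - 1) * (r ^ m * exp (- r\<^sup>2))) c"
    using c(2) by (rule has_bochner_integral_cong_AE[THEN iffD1, rotated 3]) (use ae in auto)
  then show "integrable (radial_measure d) (\<lambda>r. r ^ m * exp (- r\<^sup>2))"
    "integral\<^sup>L (radial_measure d) (\<lambda>r. r ^ m * exp (- r\<^sup>2)) > 0"
    using c(1) by (auto simp: integrable_radial_measure_iff has_bochner_integral_iff)
qed

lemma monomial_fun_gaussian:
  "monomial_fun \<alpha> x * exp (- (norm x)\<^sup>2) = (\<Prod>i\<in>UNIV. (x $ i) ^ \<alpha> i * exp (- (x $ i)\<^sup>2))"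
proof -
  have "exp (- (norm x)\<^sup>2) = (\<Prod>i\<in>UNIV. exp (- (x $ i)\<^sup>2))"
    unfolding norm_squared_eq by (simp add: exp_sum power2_eq_square flip: sum_negf)
  then show ?thesis by (simp add: monomial_fun_def prod.distrib)
qed

lemma integrable_polyfun_gaussian:
  fixes f :: "real ^ 'n::finite \<Rightarrow> real"
  assumes "f \<in> polyfun"
  shows "integrable lborel (\<lambda>x. f x * exp (- (norm x)\<^sup>2))"
  using assms unfolding polyfun_def
proof (induction rule: span_induct_alt)
  case (step c g f)
  have "integrable lborel (\<lambda>x. g x * exp (- (norm x)\<^sup>2))"
    using step(1) by (auto simp: monomial_fun_gaussian intro!: integrable_lborel_vec_prod integrable_gaussian_moment)
  then have "integrable lborel (\<lambda>x. c * (g x * exp (- (norm x)\<^sup>2)) + f x * exp (- (norm x)\<^sup>2))"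
    using step(2) by simp
  then show ?case by (simp add: algebra_simps)
qed simp

text \<open>Both integrals factor over the coordinates and differ only in the i-th factor, where
  \<open>gaussian_moment_parts\<close> applies.\<close>

lemma gaussian_monomial_parts:
  fixes \<alpha> :: "'n::finite \<Rightarrow> nat"
  shows "(\<integral>x. real (\<alpha> i) * monomial_fun (\<alpha>(i := \<alpha> i - 1)) x * exp (- (norm x)\<^sup>2) \<partial>lborel)
    = 2 * (\<integral>x. x $ i * monomial_fun \<alpha> x * exp (- (norm x)\<^sup>2) \<partial>lborel)"
proof -
  let ?M = "\<lambda>k. \<integral>(x::real). x ^ k * exp (- x\<^sup>2) \<partial>lborel"
  have int: "(\<integral>x. monomial_fun (\<alpha>(i := k)) x * exp (- (norm x)\<^sup>2) \<partial>lborel)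
      = ?M k * (\<Prod>j\<in>UNIV - {i}. ?M (\<alpha> j))" for k
  proof -
    have "(\<integral>x. monomial_fun (\<alpha>(i := k)) x * exp (- (norm x)\<^sup>2) \<partial>lborel)
        = (\<Prod>j\<in>UNIV. ?M ((\<alpha>(i := k)) j))"
      unfolding monomial_fun_gaussian by (rule integral_lborel_vec_prod) (rule integrable_gaussian_moment)
    also have "\<dots> = ?M k * (\<Prod>j\<in>UNIV - {i}. ?M (\<alpha> j))"
      by (subst prod.remove[of UNIV i]) (auto intro!: prod.cong)
    finally show ?thesis .
  qed
  have x: "x $ i * monomial_fun \<alpha> x = monomial_fun (\<alpha>(i := \<alpha> i + 1)) x" for x :: "real ^ 'n"
    unfolding monomial_fun_def by (subst (1 2) prod.remove[of UNIV i]) (auto intro!: prod.cong)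
  show ?thesis
    unfolding x using int[of "\<alpha> i - 1"] int[of "\<alpha> i + 1"] gaussian_moment_parts[of "\<alpha> i"]
    by (simp add: mult.assoc)
qed

text \<open>The factor \<open>2 * x $ i\<close> is minus the logarithmic derivative of the Gaussian.
  Both sides are linear in \<open>f\<close>, which leaves monomials; as in Euler's identity, the
  induction carries membership along.\<close>

lemma gaussian_parts:
  fixes f :: "real ^ 'n::finite \<Rightarrow> real"
  assumes "f \<in> homogeneous_space m"
  shows "(\<integral>x. partial_deriv i f x * exp (- (norm x)\<^sup>2) \<partial>lborel)
    = 2 * (\<integral>x. x $ i * f x * exp (- (norm x)\<^sup>2) \<partial>lborel)"
proof -
  have "f \<in> homogeneous_space m \<and> (\<integral>x. partial_deriv i f x * exp (- (norm x)\<^sup>2) \<partial>lborel)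
    = 2 * (\<integral>x. x $ i * f x * exp (- (norm x)\<^sup>2) \<partial>lborel)"
    if "f \<in> span {monomial_fun \<alpha> | \<alpha>. (\<Sum>i\<in>UNIV. \<alpha> i) = m}"
    using that
  proof (induction rule: span_induct_alt)
    case base
    show ?case using subspace_0[OF subspace_homogeneous[of m]] unfolding zero_fun_def
      by (simp add: partial_deriv_def)
  next
    case (step c g f)
    then obtain \<alpha> where \<alpha>: "g = monomial_fun \<alpha>" "sum \<alpha> UNIV = m" by blast
    have gh: "g \<in> homogeneous_space m" "f \<in> homogeneous_space m"
      using step by (auto simp: homogeneous_space_def intro: span_base)
    have d: "partial_deriv i (c *\<^sub>R g + f) x = c * partial_deriv i g x + partial_deriv i f x" for x
      by (subst line_deriv_partial_deriv[OF line_deriv_lincomb])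
         (auto intro: line_deriv_homogeneous gh)
    have int1: "integrable lborel (\<lambda>x. partial_deriv i f x * exp (- (norm x)\<^sup>2))"
      if "f \<in> homogeneous_space m" for f
      using line_deriv_homogeneous(2)[OF that] homogeneous_subset_polyfun
      by (intro integrable_polyfun_gaussian) blast
    have int2: "integrable lborel (\<lambda>x. x $ i * f x * exp (- (norm x)\<^sup>2))"
      if "f \<in> homogeneous_space m" for f
      using homogeneous_mult[OF coordinate_homogeneous that] homogeneous_subset_polyfun
      by (intro integrable_polyfun_gaussian) blast
    have g: "(\<integral>x. partial_deriv i g x * exp (- (norm x)\<^sup>2) \<partial>lborel)
      = 2 * (\<integral>x. x $ i * g x * exp (- (norm x)\<^sup>2) \<partial>lborel)"
      unfolding \<alpha>(1) line_deriv_partial_deriv[OF line_deriv_monomial] by (rule gaussian_monomial_parts)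
    have "(\<integral>x. partial_deriv i (c *\<^sub>R g + f) x * exp (- (norm x)\<^sup>2) \<partial>lborel)
      = (\<integral>x. c * (partial_deriv i g x * exp (- (norm x)\<^sup>2)) + partial_deriv i f x * exp (- (norm x)\<^sup>2) \<partial>lborel)"
      by (simp only: d) (simp only: algebra_simps)
    also have "\<dots> = c * (\<integral>x. partial_deriv i g x * exp (- (norm x)\<^sup>2) \<partial>lborel)
        + (\<integral>x. partial_deriv i f x * exp (- (norm x)\<^sup>2) \<partial>lborel)"
      using int1 gh by simp
    also have "\<dots> = 2 * (c * (\<integral>x. x $ i * g x * exp (- (norm x)\<^sup>2) \<partial>lborel)
        + (\<integral>x. x $ i * f x * exp (- (norm x)\<^sup>2) \<partial>lborel))"
      using step g by simp
    also have "c * (\<integral>x. x $ i * g x * exp (- (norm x)\<^sup>2) \<partial>lborel)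
        + (\<integral>x. x $ i * f x * exp (- (norm x)\<^sup>2) \<partial>lborel)
      = (\<integral>x. c * (x $ i * g x * exp (- (norm x)\<^sup>2)) + x $ i * f x * exp (- (norm x)\<^sup>2) \<partial>lborel)"
      using int2 gh by simp
    also have "\<dots> = (\<integral>x. x $ i * (c *\<^sub>R g + f) x * exp (- (norm x)\<^sup>2) \<partial>lborel)"
      by (simp add: algebra_simps)
    finally show ?case
      using subspace_add[OF subspace_homogeneous subspace_scale[OF subspace_homogeneous gh(1)] gh(2)]
      by blast
  qed
  with assms show ?thesis by (simp add: homogeneous_space_def)
qed

text \<open>Apply \<open>gaussian_parts\<close> to \<open>Y\<close> times the i-th derivative of
  \<open>Z\<close> and sum over \<open>i\<close>: on the left the term with the Laplacian of
  \<open>Z\<close> vanishes, on the right Euler's identity for \<open>Z\<close> produces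
  \<open>m\<close>. The left side is symmetric in \<open>Y\<close> and \<open>Z\<close>, so
  exchanging two harmonic polynomials lets their degrees be compared.\<close>

lemma gaussian_harmonic_identity:
  fixes Y Z :: "real ^ 'n::finite \<Rightarrow> real"
  assumes Y: "Y \<in> homogeneous_space k" and Z: "Z \<in> harmonic_space m"
  shows "(\<integral>x. (\<Sum>i\<in>UNIV. partial_deriv i Y x * partial_deriv i Z x) * exp (- (norm x)\<^sup>2) \<partial>lborel)
    = 2 * real m * (\<integral>x. Y x * Z x * exp (- (norm x)\<^sup>2) \<partial>lborel)"
proof -
  have Zh: "Z \<in> homogeneous_space m" and Z0: "laplacian Z x = 0" for x
    using Z by (auto simp: harmonic_space_def)
  let ?w = "\<lambda>x :: real ^ 'n. exp (- (norm x)\<^sup>2)"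
  note Z1 = line_deriv_homogeneous(2)[OF Zh] and Y1 = line_deriv_homogeneous(2)[OF Y]
  note Z2 = line_deriv_homogeneous(2)[OF Z1]
  have int: "integrable lborel (\<lambda>x. f x * g x * ?w x)"
    if "f \<in> homogeneous_space a" "g \<in> homogeneous_space b" for f g and a b
    using homogeneous_mult[OF that] homogeneous_subset_polyfun by (intro integrable_polyfun_gaussian) blast
  have d: "partial_deriv i (\<lambda>x. Y x * partial_deriv i Z x)
      = (\<lambda>x. partial_deriv i Y x * partial_deriv i Z x + Y x * partial_deriv i (partial_deriv i Z) x)" for i
    by (intro line_deriv_partial_deriv line_deriv_mult line_deriv_homogeneous(1)[OF Y] line_deriv_homogeneous(1)[OF Z1])
  have p: "(\<integral>x. partial_deriv i Y x * partial_deriv i Z x * ?w x + Y x * partial_deriv i (partial_deriv i Z) x * ?w x \<partial>lborel)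
      = 2 * (\<integral>x. x $ i * (Y x * partial_deriv i Z x) * ?w x \<partial>lborel)" for i
    using gaussian_parts[OF homogeneous_mult[OF Y Z1], of i i] by (simp only: d distrib_right)
  \<comment> \<open>Adding \<open>Y\<close> times the Laplacian of \<open>Z\<close>, which is zero,
    completes each summand to a full derivative.\<close>
  have "(\<integral>x. (\<Sum>i\<in>UNIV. partial_deriv i Y x * partial_deriv i Z x) * ?w x \<partial>lborel)
      = (\<integral>x. (\<Sum>i\<in>UNIV. partial_deriv i Y x * partial_deriv i Z x * ?w x
           + Y x * partial_deriv i (partial_deriv i Z) x * ?w x) \<partial>lborel)"
    using Z0 by (simp add: sum.distrib flip: sum_distrib_right sum_distrib_left laplacian_def)
  also have "\<dots> = (\<Sum>i\<in>UNIV. 2 * (\<integral>x. x $ i * (Y x * partial_deriv i Z x) * ?w x \<partial>lborel))"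
    unfolding p[symmetric]
    by (intro Bochner_Integration.integral_sum Bochner_Integration.integrable_add int[OF Y1 Z1] int[OF Y Z2])
  also have "\<dots> = 2 * (\<integral>x. (\<Sum>i\<in>UNIV. x $ i * (Y x * partial_deriv i Z x) * ?w x) \<partial>lborel)"
    by (subst Bochner_Integration.integral_sum)
       (auto simp: sum_distrib_left intro!: int[OF coordinate_homogeneous homogeneous_mult[OF Y Z1]])
  also have "(\<lambda>x. \<Sum>i\<in>UNIV. x $ i * (Y x * partial_deriv i Z x) * ?w x)
      = (\<lambda>x. real m * (Y x * Z x * ?w x))"
  proof
    fix x
    have "(\<Sum>i\<in>UNIV. x $ i * (Y x * partial_deriv i Z x) * ?w x)
        = Y x * ?w x * (\<Sum>i\<in>UNIV. x $ i * partial_deriv i Z x)"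
      by (simp add: sum_distrib_left algebra_simps)
    then show "(\<Sum>i\<in>UNIV. x $ i * (Y x * partial_deriv i Z x) * ?w x) = real m * (Y x * Z x * ?w x)"
      by (simp add: euler_homogeneous[OF Zh])
  qed
  finally show ?thesis by simp
qed

lemma integrable_sphere_polyfun:
  fixes f :: "real ^ 'n::finite \<Rightarrow> real"
  assumes "f \<in> polyfun"
  shows "integrable sphere_surface f"
proof -
  interpret finite_measure "sphere_surface :: (real ^ 'n) measure" by (rule finite_measure_sphere_surface)
  have "compact (f ` sphere 0 1)"
    using continuous_polyfun[OF assms] by (intro compact_continuous_image) (auto intro: continuous_on_subset)
  then obtain C where "\<And>x. x \<in> sphere 0 1 \<Longrightarrow> norm (f x) \<le> C"
    using compact_imp_bounded bounded_iff by (metis imageI)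
  then show ?thesis
    using measurable_polyfun[OF assms]
    by (intro integrable_const_bound[of _ C] AE_I2)
       (auto intro!: measurable_restrict_space1 simp: measurable_cong_sets[OF sets_sphere_surface refl])
qed

lemma homogeneous_polar:
  assumes "f \<in> homogeneous_space m"
  shows "f x = norm x ^ m * f (sgn x)"
proof (cases "x = 0")
  \<comment> \<open>Since \<open>sgn 0 = 0\<close>, the claim reads
    \<open>f 0 = 0 ^ m * f 0\<close>: both sides vanish for positive \<open>m\<close>, and
    \<open>0 ^ 0 = 1\<close> settles \<open>m = 0\<close>.\<close>
  case True
  then show ?thesis
    using homogeneous_scale[OF assms, of 0 0] by (cases m) auto
next
  case False
  then show ?thesis
    using homogeneous_scale[OF assms, of "norm x" "sgn x"] by (simp add: sgn_div_norm)
qed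

text \<open>
  Green's identity for the Gaussian weight: integrating \<open>\<nabla>Y \<bullet> \<nabla>Z\<close> by parts either way gives
  \<open>2 m\<close> and \<open>2 k\<close> times the Gaussian inner product of \<open>Y\<close> and \<open>Z\<close>, which is a positive multiple of
  the one on the sphere.
\<close>

theorem harmonic_orthogonal:
  fixes Y Z :: "real ^ 'n::finite \<Rightarrow> real"
  assumes Y: "Y \<in> harmonic_space k" and Z: "Z \<in> harmonic_space m" and "k \<noteq> m"
  shows "(\<integral>\<xi>. Y \<xi> * Z \<xi> \<partial>sphere_surface) = 0"
proof -
  have Yh: "Y \<in> homogeneous_space k" and Zh: "Z \<in> homogeneous_space m"
    using Y Z by (auto simp: harmonic_space_def)
  note YZ = homogeneous_mult[OF Yh Zh]
  have YZp: "(\<lambda>x. Y x * Z x) \<in> polyfun" using YZ homogeneous_subset_polyfun by blast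
  have "2 * real m * (\<integral>x. Y x * Z x * exp (- (norm x)\<^sup>2) \<partial>lborel)
      = 2 * real k * (\<integral>x. Y x * Z x * exp (- (norm x)\<^sup>2) \<partial>lborel)"
    using gaussian_harmonic_identity[OF Yh Z] gaussian_harmonic_identity[OF Zh Y]
    by (simp add: mult.commute)
  then have "(\<integral>x. Y x * Z x * exp (- (norm x)\<^sup>2) \<partial>lborel) = 0"
    using \<open>k \<noteq> m\<close> by simp
  moreover have "(\<integral>x. Y x * Z x * exp (- (norm x)\<^sup>2) \<partial>lborel)
      = integral\<^sup>L (radial_measure CARD('n)) (\<lambda>r. r ^ (k + m) * exp (- r\<^sup>2))
        * (\<integral>\<xi>. Y \<xi> * Z \<xi> \<partial>sphere_surface)"
  proof (rule polar_integral(2)[OF gaussian_radial_moment(1) integrable_sphere_polyfun[OF YZp]])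
    show "(\<lambda>x. Y x * Z x * exp (- (norm x)\<^sup>2)) \<in> borel_measurable borel"
      using measurable_polyfun[OF YZp] by measurable
    show "Y x * Z x * exp (- (norm x)\<^sup>2)
        = norm x ^ (k + m) * exp (- (norm x)\<^sup>2) * (Y (sgn x) * Z (sgn x))" for x
      using homogeneous_polar[OF YZ, of x] by simp
  qed
  ultimately show ?thesis
    using gaussian_radial_moment(2)[where d = "CARD('n)" and m = "k + m"] by simp
qed

section \<open>The inner product on the ball\<close>

text \<open>One polynomial argument suffices because the inner product of \<open>p\<close> and
  \<open>q\<close> depends on \<open>p * q\<close> only.\<close>

definition jacobi_integral :: "real \<Rightarrow> real \<Rightarrow> real poly \<Rightarrow> real" where
  "jacobi_integral a b p = (LINT t:{-1..1}|lborel. poly p t * (1 - t) powr a * (1 + t) powr b)"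

text \<open>The substitution \<open>u = (1 + t) / 2\<close> turns the weight into a Beta integrand,
  and a polynomial is bounded on the compact interval.\<close>

lemma set_integrable_jacobi:
  assumes "a > -1" and "b > -1"
  shows "set_integrable lborel {-1..1::real} (\<lambda>t. poly p t * (1 - t) powr a * (1 + t) powr b)"
proof -
  have "set_integrable lborel {(1 + (-1)) / 2..(1 + 1) / 2} (\<lambda>u::real. u powr b * (1 - u) powr a)"
    using integrable_Beta[of "b + 1" "a + 1"] assms by simp
  then have "set_integrable lborel {-1..1} (\<lambda>t::real. ((1 + t) / 2) powr b * (1 - (1 + t) / 2) powr a * (1 / 2))"
    by (rule integral_substitution(1)) (auto intro!: derivative_eq_intros)
  \<comment> \<open>The exponent \<open>a + b\<close> undoes the halving inside the two powers, the
    extra \<open>1\<close> undoes the Jacobian \<open>1 / 2\<close>.\<close>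
  then have "set_integrable lborel {-1..1} (\<lambda>t::real. 2 powr (a + b + 1) *
      (((1 + t) / 2) powr b * (1 - (1 + t) / 2) powr a * (1 / 2)))"
    by simp
  also have "?this \<longleftrightarrow> set_integrable lborel {-1..1} (\<lambda>t::real. (1 - t) powr a * (1 + t) powr b)"
  proof (rule set_integrable_cong)
    fix t :: real assume t: "t \<in> {-1..1}"
    have h: "1 - (1 + t) / 2 = (1 - t) / 2" by (simp add: field_simps)
    show "2 powr (a + b + 1) * (((1 + t) / 2) powr b * (1 - (1 + t) / 2) powr a * (1 / 2))
        = (1 - t) powr a * (1 + t) powr b"
      unfolding h using t by (simp add: powr_divide powr_add)
  qed auto
  finally have w: "set_integrable lborel {-1..1} (\<lambda>t::real. (1 - t) powr a * (1 + t) powr b)" .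
  have "compact (poly p ` {-1..1})" by (intro compact_continuous_image continuous_intros) simp
  then obtain C where C: "\<And>t. t \<in> {-1..1} \<Longrightarrow> \<bar>poly p t\<bar> \<le> C"
    using compact_imp_bounded bounded_iff by (metis imageI real_norm_def)
  have [measurable]: "poly p \<in> borel_measurable borel"
    by (intro borel_measurable_continuous_onI continuous_intros)
  have "set_integrable lborel {-1..1} (\<lambda>t::real. C * ((1 - t) powr a * (1 + t) powr b))"
    using w by simp
  then show ?thesis
    unfolding set_integrable_def
  proof (rule Bochner_Integration.integrable_bound)
    show "AE t in lborel. norm (indicator {-1..1} t *\<^sub>R (poly p t * (1 - t) powr a * (1 + t) powr b))
      \<le> norm (indicator {-1..1} t *\<^sub>R (C * ((1 - t) powr a * (1 + t) powr b)))"
    proof (rule AE_I2)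
      fix t :: real
      show "norm (indicator {-1..1} t *\<^sub>R (poly p t * (1 - t) powr a * (1 + t) powr b))
        \<le> norm (indicator {-1..1} t *\<^sub>R (C * ((1 - t) powr a * (1 + t) powr b)))"
      proof (cases "t \<in> {-1..1}")
        case True
        have "\<bar>poly p t\<bar> * ((1 - t) powr a * (1 + t) powr b) \<le> \<bar>C\<bar> * ((1 - t) powr a * (1 + t) powr b)"
          using C[OF True] by (intro mult_right_mono) auto
        with True show ?thesis by (simp add: abs_mult mult.assoc)
      qed simp
    qed
  qed measurable
qed

text \<open>Substitution \<open>t = 2 * r\<^sup>2 - 1\<close>: the density
  \<open>r ^ (N + d - 1)\<close> is \<open>r\<close> times the power \<open>b\<close> of
  \<open>r\<^sup>2\<close>. The factors \<open>2 powr a\<close> and \<open>2 powr b\<close> from the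
  weight and 4 from the Jacobian make up \<open>2 powr (a + b + 2)\<close>.\<close>

lemma radial_jacobi:
  fixes p :: "real poly" and N d :: nat
  assumes "a > -1" and "d \<ge> 2"
  defines "b \<equiv> (real N + real d - 2) / 2"
  defines "F \<equiv> \<lambda>r. indicator {..1} r * (poly p (2 * r\<^sup>2 - 1) * r ^ N * (1 - r\<^sup>2) powr a)"
  shows "integrable (radial_measure d) F"
    and "integral\<^sup>L (radial_measure d) F = jacobi_integral a b p / 2 powr (a + b + 2)"
proof -
  have [measurable]: "poly p \<in> borel_measurable borel"
    by (intro borel_measurable_continuous_onI continuous_intros)
  have F[measurable]: "F \<in> borel_measurable borel" unfolding F_def by measurable
  let ?f = "\<lambda>t. poly p t * (1 - t) powr a * (1 + t) powr b"
  let ?g = "\<lambda>r::real. 2 * r\<^sup>2 - 1"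
  have int: "set_integrable lborel {?g 0..?g 1} ?f"
    using set_integrable_jacobi[of a b p] assms by (simp add: b_def)
  have D: "(?g has_real_derivative 4 * r) (at r)" for r
    by (auto intro!: derivative_eq_intros)
  have C: "continuous_on {0..1} (\<lambda>r::real. 4 * r)" by (intro continuous_intros)
  note sub = integral_substitution[OF int D C]
  have eq: "indicator {0<..} r * r ^ (d - 1) * F r = (1 / 2 powr (a + b + 2)) * (indicator {0..1} r *\<^sub>R (?f (?g r) * (4 * r)))" for r
  proof (cases "0 < r \<and> r \<le> 1")
    case True
    have "(1 - ?g r) powr a = 2 powr a * (1 - r\<^sup>2) powr a"
    proof -
      have "1 - ?g r = 2 * (1 - r\<^sup>2)" by simp
      moreover have "0 \<le> 1 - r\<^sup>2" using True by (simp add: power_le_one)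
      ultimately show ?thesis by (simp only: powr_mult)
    qed
    moreover have "(1 + ?g r) powr b * r = 2 powr b * (r ^ N * r ^ (d - 1))"
    proof -
      have b2: "2 * b = real N + real d - 2" by (simp add: b_def)
      have r2: "r\<^sup>2 = r powr 2" using True by (simp add: powr_numeral)
      have "(1 + ?g r) powr b = 2 powr b * (r\<^sup>2) powr b"
        using True by (simp add: powr_mult)
      also have "(r\<^sup>2) powr b = r powr (real N + real d - 2)"
        unfolding r2 powr_powr b2 ..
      also have "real N + real d - 2 = real (N + (d - 2))"
        using \<open>d \<ge> 2\<close> by simp
      also have "r powr \<dots> = r ^ (N + (d - 2))"
        using True by (simp only: powr_realpow)
      finally have "(1 + ?g r) powr b * r = 2 powr b * (r ^ N * (r ^ (d - 2) * r))"
        by (simp add: power_add)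
      also have "r ^ (d - 2) * r = r ^ (d - 1)"
        using \<open>d \<ge> 2\<close> by (simp add: power_Suc2[symmetric] Suc_diff_le[symmetric] numeral_2_eq_2 Suc_diff_Suc)
      finally show ?thesis .
    qed
    ultimately have "?f (?g r) * (4 * r) = poly p (?g r) * (2 powr a * (1 - r\<^sup>2) powr a) * (4 * (2 powr b * (r ^ N * r ^ (d - 1))))"
      by (simp add: mult_ac)
    also have "\<dots> = 2 powr (a + b + 2) * (r ^ (d - 1) * (poly p (?g r) * r ^ N * (1 - r\<^sup>2) powr a))"
      by (simp add: powr_add)
    finally have f: "?f (?g r) * (4 * r) = 2 powr (a + b + 2) * (r ^ (d - 1) * (poly p (?g r) * r ^ N * (1 - r\<^sup>2) powr a))" .
    have "indicator {0..1} r = (1::real)" "indicator {0<..} r = (1::real)" "indicator {..1} r = (1::real)"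
      using True by auto
    then show ?thesis unfolding F_def f by simp
  next
    \<comment> \<open>At \<open>r = 0\<close> the left side vanishes through the indicator, the
      right side through the factor \<open>4 * r\<close>.\<close>
    case False
    then show ?thesis by (auto simp: F_def split: split_indicator)
  qed
  have "integrable lborel (\<lambda>r. indicator {0<..} r * r ^ (d - 1) * F r)"
    unfolding eq using sub(1) by (simp add: set_integrable_def)
  then show "integrable (radial_measure d) F" by (simp add: integrable_radial_measure_iff)
  have "integral\<^sup>L (radial_measure d) F
      = (\<integral>r. (1 / 2 powr (a + b + 2)) * (indicator {0..1} r *\<^sub>R (?f (?g r) * (4 * r))) \<partial>lborel)"
    by (simp only: integrable_radial_measure_iff F eq)
  also have "\<dots> = (1 / 2 powr (a + b + 2)) * (LBINT r. ?f (?g r) * (4 * r) * indicator {0..1} r)"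
    by (simp add: mult.commute)
  also have "(LBINT r. ?f (?g r) * (4 * r) * indicator {0..1} r) = (LBINT t. ?f t * indicator {?g 0..?g 1} t)"
    using sub(2) by simp
  also have "\<dots> = jacobi_integral a b p"
    by (simp add: jacobi_integral_def set_lebesgue_integral_def mult.commute)
  finally show "integral\<^sup>L (radial_measure d) F = jacobi_integral a b p / 2 powr (a + b + 2)"
    by simp
qed

lemma ball_radial_integral:
  fixes H :: "real ^ 'n::finite \<Rightarrow> real"
  assumes "CARD('n) \<ge> 2" and "\<mu> > - 1 / 2" and H: "H \<in> homogeneous_space N"
  defines "b \<equiv> (real N + real CARD('n) - 2) / 2"
  shows "set_integrable lborel (cball 0 1) (\<lambda>x. poly p (2 * (norm x)\<^sup>2 - 1) * H x * ball_weight \<mu> x)"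
    and "(LINT x:cball 0 1|lborel. poly p (2 * (norm x)\<^sup>2 - 1) * H x * ball_weight \<mu> x)
      = jacobi_integral (\<mu> - 1 / 2) b p / 2 powr (\<mu> + b + 3 / 2) * (\<integral>\<xi>. H \<xi> \<partial>sphere_surface)"
proof -
  have Hp: "H \<in> polyfun" using H homogeneous_subset_polyfun by blast
  have [measurable]: "poly p \<in> borel_measurable borel"
    by (intro borel_measurable_continuous_onI continuous_intros)
  note [measurable] = measurable_polyfun[OF Hp]
  have [measurable]: "cball (0 :: real ^ 'n) 1 \<in> sets borel" by simp
  let ?F = "\<lambda>r. indicator {..1} r * (poly p (2 * r\<^sup>2 - 1) * r ^ N * (1 - r\<^sup>2) powr (\<mu> - 1 / 2))"
  let ?h = "\<lambda>x. indicator (cball 0 1) x *\<^sub>R (poly p (2 * (norm x)\<^sup>2 - 1) * H x * ball_weight \<mu> x)"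
  have a: "\<mu> - 1 / 2 > -1" using assms by simp
  note F = radial_jacobi[OF a assms(1), where N = N and p = p]
  have hm: "?h \<in> borel_measurable borel" unfolding ball_weight_def by measurable
  have eq: "?h x = ?F (norm x) * H (sgn x)" for x
    using homogeneous_polar[OF H, of x] by (auto simp: ball_weight_def split: split_indicator)
  have e: "\<mu> - 1 / 2 + b + 2 = \<mu> + b + 3 / 2" by simp
  show "set_integrable lborel (cball 0 1) (\<lambda>x. poly p (2 * (norm x)\<^sup>2 - 1) * H x * ball_weight \<mu> x)"
    unfolding set_integrable_def
    by (rule polar_integral(1)[OF F(1) integrable_sphere_polyfun[OF Hp] hm eq])
  show "(LINT x:cball 0 1|lborel. poly p (2 * (norm x)\<^sup>2 - 1) * H x * ball_weight \<mu> x)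
      = jacobi_integral (\<mu> - 1 / 2) b p / 2 powr (\<mu> + b + 3 / 2) * (\<integral>\<xi>. H \<xi> \<partial>sphere_surface)"
    unfolding set_lebesgue_integral_def
    using polar_integral(2)[OF F(1) integrable_sphere_polyfun[OF Hp] hm eq] F(2)
    by (simp only: e[unfolded b_def] b_def)
qed

lemma sphere_area_pos: "sphere_area TYPE('n::finite) > 0"
  unfolding sphere_area_eq by (intro divide_pos_pos mult_pos_pos Gamma_real_pos) auto

text \<open>In polar coordinates the ball term becomes a Jacobi integral times a spherical one. On
  the sphere \<open>2 * (norm x)\<^sup>2 - 1\<close> equals 1, so there the radial factors are the
  constants \<open>poly p 1\<close> and \<open>poly q 1\<close>.\<close>

lemma ball_ip_radial:
  fixes Y Z :: "real ^ 'n::finite \<Rightarrow> real"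
  assumes "CARD('n) \<ge> 2" and "\<mu> > - 1 / 2"
    and Y: "Y \<in> homogeneous_space j" and Z: "Z \<in> homogeneous_space k"
  defines "b \<equiv> (real (j + k) + real CARD('n) - 2) / 2"
  shows "ball_ip \<mu> l (\<lambda>x. poly p (2 * (norm x)\<^sup>2 - 1) * Y x) (\<lambda>x. poly q (2 * (norm x)\<^sup>2 - 1) * Z x)
    = (1 / ball_weight_mass TYPE('n) \<mu> * (jacobi_integral (\<mu> - 1 / 2) b (p * q) / 2 powr (\<mu> + b + 3 / 2))
       + l / sphere_area TYPE('n) * (poly p 1 * poly q 1)) * (\<integral>\<xi>. Y \<xi> * Z \<xi> \<partial>sphere_surface)"
proof -
  have ball: "(LINT x:cball 0 1|lborel. poly p (2 * (norm x)\<^sup>2 - 1) * Y x * (poly q (2 * (norm x)\<^sup>2 - 1) * Z x) * ball_weight \<mu> x)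
      = jacobi_integral (\<mu> - 1 / 2) b (p * q) / 2 powr (\<mu> + b + 3 / 2) * (\<integral>\<xi>. Y \<xi> * Z \<xi> \<partial>sphere_surface)"
    using ball_radial_integral(2)[OF assms(1,2) homogeneous_mult[OF Y Z], of "p * q"]
    by (simp add: b_def mult_ac)
  have "(\<integral>\<xi>. poly p (2 * (norm \<xi>)\<^sup>2 - 1) * Y \<xi> * (poly q (2 * (norm \<xi>)\<^sup>2 - 1) * Z \<xi>) \<partial>sphere_surface)
      = (\<integral>\<xi>. poly p 1 * poly q 1 * (Y \<xi> * Z \<xi>) \<partial>sphere_surface)"
    by (rule Bochner_Integration.integral_cong) auto
  also have "\<dots> = poly p 1 * poly q 1 * (\<integral>\<xi>. Y \<xi> * Z \<xi> \<partial>sphere_surface)"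
    by (rule integral_mult_right_zero)
  finally show ?thesis
    by (simp only: ball_ip_def ball) (simp add: algebra_simps)
qed

text \<open>Total degree \<open>2 * m\<close> gives the exponent \<beta>. Passing from the plain
  spherical integral to the normalised \<open>sphere_ip\<close> releases the factor
  \<open>sphere_area\<close> that stands in \<open>jacobi_mass_ip\<close>.\<close>

lemma ball_ip_radial_harmonic:
  fixes Y Z :: "real ^ 'n::finite \<Rightarrow> real"
  assumes "CARD('n) \<ge> 2" and "\<mu> > - 1 / 2"
    and Y: "Y \<in> harmonic_space m" and Z: "Z \<in> harmonic_space m"
  shows "ball_ip \<mu> l (\<lambda>x. poly p (2 * (norm x)\<^sup>2 - 1) * Y x) (\<lambda>x. poly q (2 * (norm x)\<^sup>2 - 1) * Z x)
    = jacobi_mass_ip TYPE('n) \<mu> (real m + (real CARD('n) - 2) / 2) l p q * sphere_ip Y Z"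
proof -
  have YZ: "Y \<in> homogeneous_space m" "Z \<in> homogeneous_space m"
    using Y Z by (auto simp: harmonic_space_def)
  have b: "(real (m + m) + real CARD('n) - 2) / 2 = real m + (real CARD('n) - 2) / 2"
    by (simp add: field_simps)
  show ?thesis
    unfolding ball_ip_radial[OF assms(1,2) YZ] b
    using sphere_area_pos[where 'n = 'n]
    by (simp add: jacobi_mass_ip_def sphere_ip_def jacobi_integral_def field_simps)
qed

lemma ball_ip_radial_harmonic_orthogonal:
  fixes Y Z :: "real ^ 'n::finite \<Rightarrow> real"
  assumes "CARD('n) \<ge> 2" and "\<mu> > - 1 / 2"
    and Y: "Y \<in> harmonic_space j" and Z: "Z \<in> harmonic_space k" and "j \<noteq> k"
  shows "ball_ip \<mu> l (\<lambda>x. poly p (2 * (norm x)\<^sup>2 - 1) * Y x) (\<lambda>x. poly q (2 * (norm x)\<^sup>2 - 1) * Z x) = 0"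
proof -
  have YZ: "Y \<in> homogeneous_space j" "Z \<in> homogeneous_space k"
    using Y Z by (auto simp: harmonic_space_def)
  show ?thesis
    by (simp add: ball_ip_radial[OF assms(1,2) YZ] harmonic_orthogonal[OF Y Z \<open>j \<noteq> k\<close>])
qed

subsection \<open>Positive definiteness\<close>

text \<open>The weight alone is the case \<open>p = 1\<close>, \<open>H = 1\<close> of
  \<open>ball_radial_integral\<close>; a polynomial is bounded on the compact ball.\<close>

lemma set_integrable_polyfun_ball_weight:
  fixes f :: "real ^ 'n::finite \<Rightarrow> real"
  assumes "CARD('n) \<ge> 2" and "\<mu> > - 1 / 2" and f: "f \<in> polyfun"
  shows "set_integrable lborel (cball 0 1) (\<lambda>x. f x * ball_weight \<mu> x)"
proof -
  have w: "set_integrable lborel (cball 0 1) (ball_weight \<mu> :: real ^ 'n \<Rightarrow> real)"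
    using ball_radial_integral(1)[OF assms(1,2) one_homogeneous, of 1] by simp
  have "compact (f ` cball 0 1)"
    using continuous_polyfun[OF f] by (intro compact_continuous_image) (auto intro: continuous_on_subset)
  then obtain C where C: "\<And>x. x \<in> cball 0 1 \<Longrightarrow> \<bar>f x\<bar> \<le> C"
    using compact_imp_bounded bounded_iff by (metis imageI real_norm_def)
  note [measurable] = measurable_polyfun[OF f]
  have [measurable]: "cball (0 :: real ^ 'n) 1 \<in> sets borel" by simp
  have "set_integrable lborel (cball 0 1) (\<lambda>x :: real ^ 'n. C * ball_weight \<mu> x)"
    using w by simp
  then show ?thesis
    unfolding set_integrable_def
  proof (rule Bochner_Integration.integrable_bound)
    show "AE x in lborel. norm (indicator (cball 0 1) x *\<^sub>R (f x * ball_weight \<mu> x))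
      \<le> norm (indicator (cball 0 1) x *\<^sub>R (C * ball_weight \<mu> x))"
    proof (rule AE_I2)
      fix x :: "real ^ 'n"
      show "norm (indicator (cball 0 1) x *\<^sub>R (f x * ball_weight \<mu> x))
        \<le> norm (indicator (cball 0 1) x *\<^sub>R (C * ball_weight \<mu> x))"
        using C[of x] by (auto simp: abs_mult split: split_indicator intro!: mult_right_mono)
    qed
  qed (unfold ball_weight_def, measurable)
qed

text \<open>Restriction to a line through the origin reduces the identity theorem to finiteness of
  the roots of a univariate polynomial.\<close>

lemma polyfun_line:
  assumes "f \<in> polyfun"
  shows "\<exists>p. \<forall>t. f (t *\<^sub>R x) = poly p t"
  using assms unfolding polyfun_def
proof (induction rule: span_induct_alt)
  case base
  show ?case by (rule exI[of _ 0]) simp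
next
  case (step c g f)
  then obtain \<alpha> p where "g = monomial_fun \<alpha>" and p: "\<And>t. f (t *\<^sub>R x) = poly p t" by blast
  then have g: "g (t *\<^sub>R x) = poly (monom (g x) (sum \<alpha> UNIV)) t" for t
    by (simp add: monomial_fun_def power_mult_distrib prod.distrib power_sum poly_monom)
  show ?case by (rule exI[of _ "smult c (monom (g x) (sum \<alpha> UNIV)) + p"]) (simp add: g p)
qed

lemma poly_zero_if_zero_on_pos:
  fixes p :: "real poly"
  assumes "\<And>t. 0 < t \<Longrightarrow> t < c \<Longrightarrow> poly p t = 0" and "c > 0"
  shows "p = 0"
proof (rule ccontr)
  assume "p \<noteq> 0"
  then have "finite {t. poly p t = 0}" by (rule poly_roots_finite)
  moreover have "{0<..<c} \<subseteq> {t. poly p t = 0}" using assms(1) by auto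
  ultimately have "finite {0<..<c}" by (rule finite_subset[rotated])
  then show False using assms(2) by (simp add: infinite_Ioo)
qed

lemma polyfun_zero_if_zero_on_ball:
  fixes f :: "real ^ 'n::finite \<Rightarrow> real"
  assumes f: "f \<in> polyfun" and zero: "\<And>x. norm x < 1 \<Longrightarrow> f x = 0"
  shows "f = 0"
proof
  fix x
  obtain p where p: "\<And>t. f (t *\<^sub>R x) = poly p t" using polyfun_line[OF f] by blast
  have "p = 0"
  proof (rule poly_zero_if_zero_on_pos)
    \<comment> \<open>The summand 1 keeps the bound meaningful for \<open>x = 0\<close>.\<close>
    fix t :: real assume t: "0 < t" "t < 1 / (1 + norm x)"
    have "t * norm x \<le> t * (1 + norm x)" using t by (intro mult_left_mono) auto
    also have "\<dots> < 1" using t by (simp add: field_simps add_pos_nonneg)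
    finally show "poly p t = 0" using t by (simp add: zero flip: p)
  qed (simp add: add_pos_nonneg)
  then show "f x = 0 x" using p[of 1] by simp
qed

text \<open>The weight is positive inside the ball, so \<open>f\<close> vanishes almost everywhere
  there. The set where it does not is open and null, hence empty.\<close>

lemma polyfun_ball_weight_norm_eq_0:
  fixes f :: "real ^ 'n::finite \<Rightarrow> real"
  assumes "CARD('n) \<ge> 2" and "\<mu> > - 1 / 2" and f: "f \<in> polyfun"
    and 0: "(LINT x:cball 0 1|lborel. f x * f x * ball_weight \<mu> x) = 0"
  shows "f = 0"
proof (rule polyfun_zero_if_zero_on_ball[OF f])
  have "integrable lborel (\<lambda>x. indicator (cball 0 1) x *\<^sub>R (f x * f x * ball_weight \<mu> x))"
    using set_integrable_polyfun_ball_weight[OF assms(1,2) polyfun_mult[OF f f]]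
    by (simp add: set_integrable_def)
  moreover have "0 \<le> indicator (cball 0 1) x *\<^sub>R (f x * f x * ball_weight \<mu> x)" for x
    by (simp add: ball_weight_def)
  ultimately have "AE x in lborel. indicator (cball 0 1) x *\<^sub>R (f x * f x * ball_weight \<mu> x) = 0"
    using 0 unfolding set_lebesgue_integral_def
    by (subst (asm) integral_nonneg_eq_0_iff_AE) auto
  then have ae: "AE x in lborel. \<not> (norm x < 1 \<and> f x \<noteq> 0)"
  proof eventually_elim
    case (elim x)
    show ?case
    proof safe
      assume "norm x < 1" "f x \<noteq> 0"
      moreover from this have "(norm x)\<^sup>2 < 1" by (simp add: abs_square_less_1)
      ultimately show False using elim by (simp add: ball_weight_def)
    qed
  qed
  let ?U = "{x. norm x < 1 \<and> f x \<noteq> 0}"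
  have U: "open ?U"
    using continuous_polyfun[OF f]
    by (intro open_Collect_conj open_Collect_less open_Collect_neq continuous_intros) auto
  then have "emeasure lborel ?U = 0"
    using ae AE_iff_measurable[of ?U lborel "\<lambda>x. \<not> (norm x < 1 \<and> f x \<noteq> 0)"] by simp
  with U have "negligible ?U"
    by (simp add: negligible_iff_null_sets null_sets_completionI null_setsI)
  then have "?U = {}" using open_not_negligible[OF U] by blast
  then show "\<And>x. norm x < 1 \<Longrightarrow> f x = 0" by blast
qed

text \<open>The mass is the squared weighted norm of the constant 1, so definiteness excludes
  zero.\<close>

lemma ball_weight_mass_pos:
  assumes "CARD('n::finite) \<ge> 2" and "\<mu> > - 1 / 2"
  shows "ball_weight_mass TYPE('n) \<mu> > 0"
proof -
  have one: "(\<lambda>x :: real ^ 'n. 1) \<in> polyfun"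
    using one_homogeneous homogeneous_subset_polyfun by blast
  have "ball_weight_mass TYPE('n) \<mu> \<ge> 0"
    unfolding ball_weight_mass_def set_lebesgue_integral_def
    by (intro Bochner_Integration.integral_nonneg) (simp add: ball_weight_def)
  moreover have "ball_weight_mass TYPE('n) \<mu> \<noteq> 0"
    using polyfun_ball_weight_norm_eq_0[OF assms one]
    by (auto simp: ball_weight_mass_def fun_eq_iff)
  ultimately show ?thesis by simp
qed

lemma ball_ip_self_eq_0:
  fixes f :: "real ^ 'n::finite \<Rightarrow> real"
  assumes "CARD('n) \<ge> 2" and "\<mu> > - 1 / 2" and "l > 0" and f: "f \<in> polyfun"
    and 0: "ball_ip \<mu> l f f = 0"
  shows "f = 0"
proof -
  have "(LINT x:cball 0 1|lborel. f x * f x * ball_weight \<mu> x) \<ge> 0"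
    unfolding set_lebesgue_integral_def
    by (intro Bochner_Integration.integral_nonneg) (simp add: ball_weight_def)
  moreover have "l / sphere_area TYPE('n) * (\<integral>\<xi>. f \<xi> * f \<xi> \<partial>sphere_surface) \<ge> 0"
    using sphere_area_pos[where 'n = 'n] \<open>l > 0\<close>
    by (intro mult_nonneg_nonneg[of "l / _"] Bochner_Integration.integral_nonneg) auto
  moreover have "1 / ball_weight_mass TYPE('n) \<mu> > 0"
    using ball_weight_mass_pos[OF assms(1,2)] by simp
  ultimately have "(LINT x:cball 0 1|lborel. f x * f x * ball_weight \<mu> x) = 0"
    using 0 unfolding ball_ip_def by (smt (verit) mult_pos_pos)
  then show ?thesis by (rule polyfun_ball_weight_norm_eq_0[OF assms(1,2) f])
qed

section \<open>Symmetry and linearity of the inner product on polynomials\<close>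

lemma ball_ip_commute: "ball_ip \<mu> l f g = ball_ip \<mu> l g f"
  by (simp add: ball_ip_def mult.commute)

lemma ball_ip_lincomb:
  fixes f g h :: "real ^ 'n::finite \<Rightarrow> real"
  assumes "CARD('n) \<ge> 2" and "\<mu> > - 1 / 2"
    and f: "f \<in> polyfun" and g: "g \<in> polyfun" and h: "h \<in> polyfun"
  shows "ball_ip \<mu> l f (c *\<^sub>R g + h) = c * ball_ip \<mu> l f g + ball_ip \<mu> l f h"
proof -
  have b: "set_integrable lborel (cball 0 1) (\<lambda>x. f x * g x * ball_weight \<mu> x)" if "g \<in> polyfun" for g
    using set_integrable_polyfun_ball_weight[OF assms(1,2) polyfun_mult[OF f that]] .
  have "(LINT x:cball 0 1|lborel. f x * (c *\<^sub>R g + h) x * ball_weight \<mu> x)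
      = (LINT x:cball 0 1|lborel. c * (f x * g x * ball_weight \<mu> x) + f x * h x * ball_weight \<mu> x)"
    by (rule arg_cong[where f = "set_lebesgue_integral _ _"]) (simp add: algebra_simps fun_eq_iff)
  also have "\<dots> = c * (LINT x:cball 0 1|lborel. f x * g x * ball_weight \<mu> x)
      + (LINT x:cball 0 1|lborel. f x * h x * ball_weight \<mu> x)"
    using b[OF g] b[OF h] by (subst set_integral_add(2)) auto
  finally have 1: "(LINT x:cball 0 1|lborel. f x * (c *\<^sub>R g + h) x * ball_weight \<mu> x)
      = c * (LINT x:cball 0 1|lborel. f x * g x * ball_weight \<mu> x)
      + (LINT x:cball 0 1|lborel. f x * h x * ball_weight \<mu> x)" .
  have s: "integrable sphere_surface (\<lambda>x. f x * g x)" if "g \<in> polyfun" for g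
    using integrable_sphere_polyfun[OF polyfun_mult[OF f that]] .
  have "(\<integral>\<xi>. f \<xi> * (c *\<^sub>R g + h) \<xi> \<partial>sphere_surface)
      = (\<integral>\<xi>. c * (f \<xi> * g \<xi>) + f \<xi> * h \<xi> \<partial>sphere_surface)"
    by (simp add: algebra_simps)
  also have "\<dots> = c * (\<integral>\<xi>. f \<xi> * g \<xi> \<partial>sphere_surface) + (\<integral>\<xi>. f \<xi> * h \<xi> \<partial>sphere_surface)"
    using s[OF g] s[OF h] by simp
  finally show ?thesis
    unfolding ball_ip_def 1 by (simp add: algebra_simps)
qed

section \<open>The orthogonal basis\<close>

text \<open>Inverting \<open>t = 2 * s - 1\<close> gives \<open>s = (1 + t) / 2\<close>; this brings
  powers of \<open>(norm x)\<^sup>2\<close> into the form that the inner product formulas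
  accept.\<close>

lemma norm_power_eq_radial_poly: "(s :: real) ^ j = poly ([:1 / 2, 1 / 2:] ^ j) (2 * s - 1)"
  by (simp add: poly_power field_simps)

text \<open>\<open>harmonic_decomposition\<close> is applied to each monomial. For
  \<open>n = 0\<close> both sides are the zero space.\<close>

lemma poly_space_harmonic_decomposition:
  "poly_space (int n - 1) \<subseteq>
    span {\<lambda>x. ((norm x)\<^sup>2) ^ j * Z x | j i Z. Z \<in> harmonic_space i \<and> 2 * j + i < n}"
    (is "_ \<subseteq> span ?D")
  unfolding poly_space_def
proof (rule span_minimal[OF _ subspace_span], safe)
  fix \<alpha> :: "'a \<Rightarrow> nat"
  assume \<alpha>: "int (sum \<alpha> UNIV) \<le> int n - 1"
  have "monomial_fun \<alpha> \<in> homogeneous_space (sum \<alpha> UNIV)"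
    unfolding homogeneous_space_def by (rule span_base) blast
  from harmonic_decomposition[OF this]
  have "monomial_fun \<alpha> \<in> span {\<lambda>x. ((norm x)\<^sup>2) ^ j * Y x | j k Y.
      Y \<in> harmonic_space k \<and> 2 * j + k = sum \<alpha> UNIV}" .
  also have "\<dots> \<subseteq> span ?D"
  proof (rule span_mono, rule subsetI)
    have less: "sum \<alpha> UNIV < n" using \<alpha> by linarith
    fix f :: "real ^ 'a \<Rightarrow> real" assume "f \<in> {\<lambda>x. ((norm x)\<^sup>2) ^ j * Y x | j k Y. Y \<in> harmonic_space k \<and> 2 * j + k = sum \<alpha> UNIV}"
    then obtain j k Y where "f = (\<lambda>x. ((norm x)\<^sup>2) ^ j * Y x)" "Y \<in> harmonic_space k" "2 * j + k < n"
      using less by auto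
    then show "f \<in> ?D" by blast
  qed
  finally show "monomial_fun \<alpha> \<in> span ?D" .
qed

text \<open>The restriction to \<open>polyfun\<close> guarantees convergence: a divergent integral
  has the default value 0, which is not linear.\<close>

lemma subspace_ball_ip_orthogonal:
  fixes f :: "real ^ 'n::finite \<Rightarrow> real"
  assumes "CARD('n) \<ge> 2" and "\<mu> > - 1 / 2" and f: "f \<in> polyfun"
  shows "subspace {g \<in> polyfun. ball_ip \<mu> l f g = 0}"
proof (rule subspaceI)
  have lin: "ball_ip \<mu> l f (c *\<^sub>R g + h) = c * ball_ip \<mu> l f g + ball_ip \<mu> l f h"
    if "g \<in> polyfun" "h \<in> polyfun" for c g h
    by (rule ball_ip_lincomb[OF assms that])
  show z: "0 \<in> {g \<in> polyfun. ball_ip \<mu> l f g = 0}"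
    using subspace_0[OF subspace_polyfun] by (simp add: ball_ip_def)
  fix c g h
  assume g: "g \<in> {g \<in> polyfun. ball_ip \<mu> l f g = 0}"
  from g z show "c *\<^sub>R g \<in> {g \<in> polyfun. ball_ip \<mu> l f g = 0}"
    using lin[of g 0 c] subspace_scale[OF subspace_polyfun, of g c] by simp
  assume h: "h \<in> {g \<in> polyfun. ball_ip \<mu> l f g = 0}"
  from g h show "g + h \<in> {g \<in> polyfun. ball_ip \<mu> l f g = 0}"
    using lin[of g h 1] subspace_add[OF subspace_polyfun, of g h] by simp
qed

lemma subspace_orth_poly_space:
  assumes "CARD('n::finite) \<ge> 2" and "\<mu> > - 1 / 2"
  shows "subspace (orth_poly_space \<mu> l n :: (real ^ 'n \<Rightarrow> real) set)"
proof -
  have "orth_poly_space \<mu> l n = poly_space (int n) \<inter>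
      (\<Inter>Q \<in> poly_space (int n - 1). {P \<in> polyfun. ball_ip \<mu> l Q P = 0} :: (real ^ 'n \<Rightarrow> real) set)"
    using poly_space_subset_polyfun unfolding orth_poly_space_def
    by (auto simp: ball_ip_commute[of \<mu> l])
  also have "subspace \<dots>"
    using poly_space_subset_polyfun
    by (intro subspace_inter subspace_poly_space subspace_Int subspace_ball_ip_orthogonal[OF assms]) blast
  finally show ?thesis .
qed

text \<open>In the variable \<open>s = (norm x)\<^sup>2\<close> the radial factor is
  \<open>q\<close> composed with \<open>2 * s - 1\<close>, of the same degree \<open>k\<close>. Its
  top coefficient is \<open>c\<close>; every other term loses at least two degrees.\<close>

lemma radial_poly_decompose:
  fixes Y :: "real ^ 'n::finite \<Rightarrow> real"
  assumes Y: "Y \<in> homogeneous_space m" and q: "degree q = k"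
  shows "\<exists>c L. (q \<noteq> 0 \<longrightarrow> c \<noteq> 0) \<and> L \<in> poly_space (int (2 * k + m) - 1) \<and>
    (\<lambda>x. poly q (2 * (norm x)\<^sup>2 - 1) * Y x) = c *\<^sub>R (\<lambda>x. ((norm x)\<^sup>2) ^ k * Y x) + L"
proof -
  let ?r = "q \<circ>\<^sub>p [:-1, 2:]"
  define L where "L = (\<Sum>j<k. coeff ?r j *\<^sub>R (\<lambda>x. ((norm x)\<^sup>2) ^ j * Y x))"
  have deg: "degree ?r = k" using q by (simp add: degree_pcompose)
  have "L \<in> poly_space (int (2 * k + m) - 1)"
    unfolding L_def
  proof (intro subspace_sum subspace_scale subspace_poly_space)
    fix j assume "j \<in> {..<k}"
    then show "(\<lambda>x. ((norm x)\<^sup>2) ^ j * Y x) \<in> poly_space (int (2 * k + m) - 1)"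
      using norm_power_mult_homogeneous[OF Y, of j]
        homogeneous_subset_poly_space[of "2 * j + m" "int (2 * k + m) - 1"] by auto
  qed
  moreover have "q \<noteq> 0 \<longrightarrow> coeff ?r k \<noteq> 0"
    using leading_coeff_0_iff[of ?r] deg pcompose_eq_0[of q "[:-1, 2:]"] by auto
  moreover have "(\<lambda>x. poly q (2 * (norm x)\<^sup>2 - 1) * Y x) = coeff ?r k *\<^sub>R (\<lambda>x. ((norm x)\<^sup>2) ^ k * Y x) + L"
  proof
    fix x :: "real ^ 'n"
    have "poly q (2 * (norm x)\<^sup>2 - 1) = poly ?r ((norm x)\<^sup>2)"
      by (simp add: poly_pcompose algebra_simps)
    also have "\<dots> = (\<Sum>j\<le>k. coeff ?r j * ((norm x)\<^sup>2) ^ j)"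
      by (simp add: poly_altdef deg)
    also have "\<dots> = coeff ?r k * ((norm x)\<^sup>2) ^ k + (\<Sum>j<k. coeff ?r j * ((norm x)\<^sup>2) ^ j)"
      by (simp add: lessThan_Suc_atMost[symmetric])
    finally show "poly q (2 * (norm x)\<^sup>2 - 1) * Y x
        = (coeff ?r k *\<^sub>R (\<lambda>x. ((norm x)\<^sup>2) ^ k * Y x) + L) x"
      by (simp add: L_def sum_fun_apply distrib_right sum_distrib_right mult.assoc)
  qed
  ultimately show ?thesis by blast
qed

lemma radial_times_homogeneous_in_poly_space:
  assumes Y: "Y \<in> homogeneous_space m" and q: "degree q = k"
  shows "(\<lambda>x. poly q (2 * (norm x)\<^sup>2 - 1) * Y x) \<in> poly_space (int (2 * k + m))"
proof -
  obtain c L where L: "L \<in> poly_space (int (2 * k + m) - 1)"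
    "(\<lambda>x. poly q (2 * (norm x)\<^sup>2 - 1) * Y x) = c *\<^sub>R (\<lambda>x. ((norm x)\<^sup>2) ^ k * Y x) + L"
    using radial_poly_decompose[OF assms] by blast
  have "(\<lambda>x. ((norm x)\<^sup>2) ^ k * Y x) \<in> poly_space (int (2 * k + m))"
    using norm_power_mult_homogeneous[OF Y] homogeneous_subset_poly_space by blast
  moreover have "L \<in> poly_space (int (2 * k + m))"
    using L(1) poly_space_mono[of "int (2 * k + m) - 1" "int (2 * k + m)"] by auto
  ultimately show ?thesis
    unfolding L(2) by (intro subspace_add subspace_scale subspace_poly_space)
qed

text \<open>It suffices to test against \<open>(norm x)\<^sup>2 ^ j * Z x\<close> with harmonic
  \<open>Z\<close>. If its degree differs from \<open>m\<close>, the spherical factor vanishes. If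
  it equals \<open>m\<close>, then \<open>2 * j + m < 2 * k + m\<close> forces \<open>j < k\<close>,
  and \<open>q\<close> is orthogonal to all polynomials of degree below \<open>k\<close>.\<close>

lemma radial_times_harmonic_in_orth_poly_space:
  fixes Y :: "real ^ 'n::finite \<Rightarrow> real"
  assumes "CARD('n) \<ge> 2" and "\<mu> > - 1 / 2"
    and Y: "Y \<in> harmonic_space m"
    and q: "is_kth_orth_poly (jacobi_mass_ip TYPE('n) \<mu> (real m + (real CARD('n) - 2) / 2) l) k q"
  shows "(\<lambda>x. poly q (2 * (norm x)\<^sup>2 - 1) * Y x) \<in> orth_poly_space \<mu> l (2 * k + m)"
proof -
  let ?Q = "\<lambda>x. poly q (2 * (norm x)\<^sup>2 - 1) * Y x"
  have deg: "degree q = k" and Yh: "Y \<in> homogeneous_space m"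
    using q Y by (auto simp: is_kth_orth_poly_def harmonic_space_def)
  have Q: "?Q \<in> poly_space (int (2 * k + m))"
    by (rule radial_times_homogeneous_in_poly_space[OF Yh deg])
  then have Qp: "?Q \<in> polyfun" using poly_space_subset_polyfun by blast
  have "poly_space (int (2 * k + m) - 1) \<subseteq> {P \<in> polyfun. ball_ip \<mu> l ?Q P = 0}"
  proof (rule order_trans[OF poly_space_harmonic_decomposition span_minimal[OF _ subspace_ball_ip_orthogonal[OF assms(1,2) Qp]]], safe)
    fix j i and Z :: "real ^ 'n \<Rightarrow> real"
    assume Z: "Z \<in> harmonic_space i" and ji: "2 * j + i < 2 * k + m"
    have Zh: "Z \<in> homogeneous_space i" using Z by (simp add: harmonic_space_def)
    then show "(\<lambda>x. ((norm x)\<^sup>2) ^ j * Z x) \<in> polyfun"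
      using norm_power_mult_homogeneous homogeneous_subset_polyfun by blast
    show "ball_ip \<mu> l ?Q (\<lambda>x. ((norm x)\<^sup>2) ^ j * Z x) = 0"
      unfolding norm_power_eq_radial_poly[of "(norm _)\<^sup>2" j]
    proof (cases "i = m")
      case True
      have "degree ([:1 / 2, 1 / 2:] ^ j :: real poly) < k"
        using degree_power_le[of "[:1 / 2, 1 / 2:] :: real poly" j] ji True by simp
      with q have "jacobi_mass_ip TYPE('n) \<mu> (real m + (real CARD('n) - 2) / 2) l q ([:1 / 2, 1 / 2:] ^ j) = 0"
        unfolding is_kth_orth_poly_def by blast
      with Z True show "ball_ip \<mu> l ?Q (\<lambda>x. poly ([:1 / 2, 1 / 2:] ^ j) (2 * (norm x)\<^sup>2 - 1) * Z x) = 0"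
        by (subst ball_ip_radial_harmonic[OF assms(1,2) Y]) auto
    next
      case False
      then show "ball_ip \<mu> l ?Q (\<lambda>x. poly ([:1 / 2, 1 / 2:] ^ j) (2 * (norm x)\<^sup>2 - 1) * Z x) = 0"
        by (intro ball_ip_radial_harmonic_orthogonal[OF assms(1,2) Y Z]) simp
    qed
  qed
  with Q show ?thesis by (auto simp: orth_poly_space_def)
qed

text \<open>Along the ray through \<xi> the homogeneous factor never vanishes, so \<open>q\<close>
  would have to vanish on an interval; the points \<open>sqrt s *\<^sub>R \<xi>\<close> have squared
  norm \<open>s\<close>.\<close>

lemma radial_times_homogeneous_nonzero:
  fixes Y :: "real ^ 'n::finite \<Rightarrow> real"
  assumes Y: "Y \<in> homogeneous_space m" and \<xi>: "norm \<xi> = 1" "Y \<xi> \<noteq> 0" and q: "q \<noteq> 0"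
  shows "(\<lambda>x. poly q (2 * (norm x)\<^sup>2 - 1) * Y x) \<noteq> 0"
proof
  assume 0: "(\<lambda>x. poly q (2 * (norm x)\<^sup>2 - 1) * Y x) = 0"
  have "q \<circ>\<^sub>p [:-1, 2:] = 0"
  proof (rule poly_zero_if_zero_on_pos[of 1])
    fix s :: real assume s: "0 < s" "s < 1"
    have "poly q (2 * (norm (sqrt s *\<^sub>R \<xi>))\<^sup>2 - 1) * Y (sqrt s *\<^sub>R \<xi>) = 0"
      using fun_cong[OF 0, of "sqrt s *\<^sub>R \<xi>"] by simp
    moreover have "Y (sqrt s *\<^sub>R \<xi>) \<noteq> 0"
      using s \<xi> by (simp add: homogeneous_scale[OF Y])
    ultimately show "poly (q \<circ>\<^sub>p [:-1, 2:]) s = 0"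
      using s \<xi> by (simp add: poly_pcompose algebra_simps)
  qed simp
  then show False using q pcompose_eq_0[of q "[:-1, 2:]"] by simp
qed

lemma independent_if_orthogonal:
  fixes b :: "'i \<Rightarrow> real ^ 'n::finite \<Rightarrow> real"
  assumes "CARD('n) \<ge> 2" and "\<mu> > - 1 / 2"
    and b: "\<And>i. i \<in> I \<Longrightarrow> b i \<in> polyfun"
    and orth: "mutually_orthogonal (ball_ip \<mu> l) I b"
    and nz: "\<And>i. i \<in> I \<Longrightarrow> ball_ip \<mu> l (b i) (b i) \<noteq> 0"
  shows "inj_on b I" and "independent (b ` I)"
proof -
  show "inj_on b I"
    using orth nz unfolding inj_on_def mutually_orthogonal_def by metis
  show "independent (b ` I)"
    unfolding dependent_def
  proof (rule notI, elim bexE imageE)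
    fix v i assume i: "i \<in> I" and v: "v = b i" "v \<in> span (b ` I - {v})"
    have "b ` I - {v} \<subseteq> {g \<in> polyfun. ball_ip \<mu> l (b i) g = 0}"
    proof
      fix g assume "g \<in> b ` I - {v}"
      then obtain j where "j \<in> I" "g = b j" "i \<noteq> j" using v by blast
      then show "g \<in> {g \<in> polyfun. ball_ip \<mu> l (b i) g = 0}"
        using i b orth by (simp add: mutually_orthogonal_def)
    qed
    then have "span (b ` I - {v}) \<subseteq> {g \<in> polyfun. ball_ip \<mu> l (b i) g = 0}"
      using subspace_ball_ip_orthogonal[OF assms(1,2) b[OF i]] by (rule span_minimal)
    then show False using nz[OF i] v by blast
  qed
qed

theorem theorem3p1:
  fixes \<mu> l :: real and n :: nat
    and Y :: "nat \<Rightarrow> nat \<Rightarrow> real ^ 'n::finite \<Rightarrow> real"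
    and q :: "nat \<Rightarrow> real poly"
  assumes "CARD('n) \<ge> 2" and "\<mu> > - 1 / 2" and "l > 0"
    and "\<And>k. 2 * k \<le> n \<Longrightarrow>
           orthonormal_basis_family sphere_ip {1..harmonic_dim TYPE('n) (n - 2 * k)}
             (Y (n - 2 * k)) (harmonic_space (n - 2 * k))"
    and "\<And>k. 2 * k \<le> n \<Longrightarrow>
           is_kth_orth_poly
             (jacobi_mass_ip TYPE('n) \<mu> (real (n - 2 * k) + (real CARD('n) - 2) / 2) l) k (q k)"
  defines "Q \<equiv> \<lambda>(k, \<nu>) x. poly (q k) (2 * (norm x)\<^sup>2 - 1) * Y (n - 2 * k) \<nu> x"
    and "I \<equiv> SIGMA k:{k. 2 * k \<le> n}. {1..harmonic_dim TYPE('n) (n - 2 * k)}"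
  shows "basis_family I Q (orth_poly_space \<mu> l n) \<and> mutually_orthogonal (ball_ip \<mu> l) I Q"
proof -

  \<comment> \<open>Membership, orthogonality and independence of the family\<close>
  let ?H = "\<lambda>k. harmonic_space (n - 2 * k) :: (real ^ 'n \<Rightarrow> real) set"
  let ?B = "\<lambda>k. {1..harmonic_dim TYPE('n) (n - 2 * k)}"
  have Yspan: "span (Y (n - 2 * k) ` ?B k) = ?H k" if "2 * k \<le> n" for k
    using assms(4)[OF that] by (auto simp: orthonormal_basis_family_def basis_family_def)
  have YH: "Y (n - 2 * k) \<nu> \<in> ?H k" if "2 * k \<le> n" "\<nu> \<in> ?B k" for k \<nu>
    using Yspan[OF that(1)] that(2) by (metis imageI span_base)
  have Yh: "Y (n - 2 * k) \<nu> \<in> homogeneous_space (n - 2 * k)" if "2 * k \<le> n" "\<nu> \<in> ?B k" for k \<nu>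
    using YH[OF that] by (simp add: harmonic_space_def)
  have Yo: "sphere_ip (Y (n - 2 * k) \<nu>) (Y (n - 2 * k) \<nu>') = (if \<nu> = \<nu>' then 1 else 0)"
    if "2 * k \<le> n" "\<nu> \<in> ?B k" "\<nu>' \<in> ?B k" for k \<nu> \<nu>'
    using assms(4)[OF that(1)] that(2,3)
    by (auto simp: orthonormal_basis_family_def mutually_orthogonal_def)
  have Q: "Q (k, \<nu>) = (\<lambda>x. poly (q k) (2 * (norm x)\<^sup>2 - 1) * Y (n - 2 * k) \<nu> x)" for k \<nu>
    by (simp add: Q_def)
  have IE: "\<exists>k \<nu>. i = (k, \<nu>) \<and> 2 * k \<le> n \<and> \<nu> \<in> ?B k" if "i \<in> I" for i
    using that by (auto simp: I_def)
  have QV: "Q i \<in> orth_poly_space \<mu> l n" if "i \<in> I" for i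
  proof -
    obtain k \<nu> where i: "i = (k, \<nu>)" "2 * k \<le> n" "\<nu> \<in> ?B k" using IE[OF \<open>i \<in> I\<close>] by blast
    show ?thesis
      using radial_times_harmonic_in_orth_poly_space[OF assms(1,2) YH[OF i(2,3)] assms(5)[OF i(2)]] i
      by (simp add: Q)
  qed
  have V: "orth_poly_space \<mu> l n \<subseteq> (polyfun :: (real ^ 'n \<Rightarrow> real) set)"
    using poly_space_subset_polyfun by (auto simp: orth_poly_space_def)
  have orth: "mutually_orthogonal (ball_ip \<mu> l) I Q"
    unfolding mutually_orthogonal_def
  proof (intro ballI impI)
    fix i j assume "i \<in> I" "j \<in> I" "i \<noteq> j"
    obtain k \<nu> where i: "i = (k, \<nu>)" "2 * k \<le> n" "\<nu> \<in> ?B k" using IE[OF \<open>i \<in> I\<close>] by blast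
    obtain k' \<nu>' where j: "j = (k', \<nu>')" "2 * k' \<le> n" "\<nu>' \<in> ?B k'" using IE[OF \<open>j \<in> I\<close>] by blast
    show "ball_ip \<mu> l (Q i) (Q j) = 0"
    proof (cases "k = k'")
      case True
      with i j \<open>i \<noteq> j\<close> show ?thesis
        by (simp add: Q ball_ip_radial_harmonic[OF assms(1,2) YH YH] Yo)
    next
      \<comment> \<open>The degrees \<open>n - 2 * k\<close> and \<open>n - 2 * k'\<close> differ
        because both indices obey \<open>2 * k \<le> n\<close>; beyond that bound truncation would
        identify them.\<close>
      case False
      with i j show ?thesis
        unfolding i(1) j(1) Q
        by (intro ball_ip_radial_harmonic_orthogonal[OF assms(1,2) YH YH]) auto
    qed
  qed
  have nz: "ball_ip \<mu> l (Q i) (Q i) \<noteq> 0" if "i \<in> I" for i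
  proof
    assume "ball_ip \<mu> l (Q i) (Q i) = 0"
    then have "Q i = 0"
      using ball_ip_self_eq_0[OF assms(1-3)] QV[OF that] V by blast
    obtain k \<nu> where i: "i = (k, \<nu>)" "2 * k \<le> n" "\<nu> \<in> ?B k" using IE[OF \<open>i \<in> I\<close>] by blast
    \<comment> \<open>A unit vector of the spherical inner product cannot vanish on the whole
      sphere.\<close>
    have "\<exists>\<xi>. norm \<xi> = 1 \<and> Y (n - 2 * k) \<nu> \<xi> \<noteq> 0"
    proof (rule ccontr)
      assume "\<not> ?thesis"
      then have "(\<integral>\<xi>. Y (n - 2 * k) \<nu> \<xi> * Y (n - 2 * k) \<nu> \<xi> \<partial>sphere_surface)
          = (\<integral>\<xi>. 0 \<partial>(sphere_surface :: (real ^ 'n) measure))"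
        by (intro Bochner_Integration.integral_cong) auto
      then show False using Yo[OF i(2,3,3)] by (simp add: sphere_ip_def)
    qed
    moreover have "q k \<noteq> 0" using assms(5)[OF i(2)] by (simp add: is_kth_orth_poly_def)
    ultimately show False
      using radial_times_homogeneous_nonzero[OF Yh[OF i(2,3)]] \<open>Q i = 0\<close> unfolding i(1) Q by blast
  qed
  have QP: "Q i \<in> polyfun" if "i \<in> I" for i using QV[OF that] V by blast
  note indep = independent_if_orthogonal[OF assms(1,2) QP orth nz]

  \<comment> \<open>Spanning modulo lower degree, and removal of the remainder\<close>
  let ?W = "span (Q ` I \<union> poly_space (int n - 1))"
  have harm: "(\<lambda>x. ((norm x)\<^sup>2) ^ k * Z x) \<in> ?W" if k: "2 * k \<le> n" and "Z \<in> ?H k" for k Z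
  proof -
    have "Z \<in> span (Y (n - 2 * k) ` ?B k)" using that Yspan by blast
    then show ?thesis
    proof (induction rule: span_induct_alt)
      case base
      show ?case using span_0[of "Q ` I \<union> poly_space (int n - 1)"] by (simp add: zero_fun_def)
    next
      case (step c y Z)
      then obtain \<nu> where \<nu>: "y = Y (n - 2 * k) \<nu>" "\<nu> \<in> ?B k" by blast
      have deg: "degree (q k) = k" and q0: "q k \<noteq> 0"
        using assms(5)[OF k] by (auto simp: is_kth_orth_poly_def)
      \<comment> \<open>Since \<open>2 * k + (n - 2 * k) = n\<close>, the remainder has degree below
        \<open>n\<close>. Because \<open>a\<close> is nonzero, the equation can be solved for
        \<open>(norm x)\<^sup>2 ^ k * y x\<close>.\<close>
      obtain a L where a: "a \<noteq> 0" and L: "L \<in> poly_space (int n - 1)"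
        and eq: "Q (k, \<nu>) = a *\<^sub>R (\<lambda>x. ((norm x)\<^sup>2) ^ k * y x) + L"
        using radial_poly_decompose[OF Yh[OF k \<nu>(2)] deg] q0 k unfolding Q \<nu>(1)
        by (metis le_add_diff_inverse)
      have "(k, \<nu>) \<in> I" using k \<nu> by (simp add: I_def)
      then have "(1 / a) *\<^sub>R (Q (k, \<nu>) - L) \<in> ?W"
        using L by (intro span_scale span_diff) (auto intro: span_base)
      also have "(1 / a) *\<^sub>R (Q (k, \<nu>) - L) = (\<lambda>x. ((norm x)\<^sup>2) ^ k * y x)"
        using a by (simp add: eq)
      finally have "c *\<^sub>R (\<lambda>x. ((norm x)\<^sup>2) ^ k * y x) + (\<lambda>x. ((norm x)\<^sup>2) ^ k * Z x) \<in> ?W"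
        using step(2) by (intro span_add span_scale)
      then show ?case by (simp add: plus_fun_def scaleR_fun_def algebra_simps)
    qed
  qed
  have "homogeneous_space n \<subseteq> ?W"
  proof
    fix P :: "real ^ 'n \<Rightarrow> real" assume "P \<in> homogeneous_space n"
    from harmonic_decomposition[OF this] show "P \<in> ?W"
    proof (rule subsetD[OF span_minimal[OF _ subspace_span], rotated], safe)
      fix j k and Z :: "real ^ 'n \<Rightarrow> real"
      assume "Z \<in> harmonic_space k" "n = 2 * j + k"
      then show "(\<lambda>x. ((norm x)\<^sup>2) ^ j * Z x) \<in> span (Q ` I \<union> poly_space (int (2 * j + k) - 1))"
        using harm[of j Z] by simp
    qed
  qed
  have top: "poly_space (int n) \<subseteq> ?W"
    unfolding poly_space_def[of "int n"]
  proof (rule span_minimal[OF _ subspace_span], safe)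
    fix \<alpha> :: "'n \<Rightarrow> nat" assume \<alpha>: "int (sum \<alpha> UNIV) \<le> int n"
    show "monomial_fun \<alpha> \<in> ?W"
    proof (cases "sum \<alpha> UNIV = n")
      case True
      then have "monomial_fun \<alpha> \<in> homogeneous_space n"
        unfolding homogeneous_space_def by (intro span_base) blast
      then show ?thesis using \<open>homogeneous_space n \<subseteq> ?W\<close> by blast
    next
      case False
      then have "int (sum \<alpha> UNIV) \<le> int n - 1" using \<alpha> by linarith
      then have "monomial_fun \<alpha> \<in> poly_space (int n - 1)"
        unfolding poly_space_def by (intro span_base) blast
      then show ?thesis by (simp add: span_base)
    qed
  qed
  have "orth_poly_space \<mu> l n \<subseteq> span (Q ` I)"
  proof
    fix P :: "real ^ 'n \<Rightarrow> real" assume P: "P \<in> orth_poly_space \<mu> l n"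
    then have "P \<in> ?W" using top by (auto simp: orth_poly_space_def)
    \<comment> \<open>The span of a union is the sum of the spans, and \<open>poly_space\<close> is
      its own span.\<close>
    then obtain u R where u: "u \<in> span (Q ` I)" and R: "R \<in> poly_space (int n - 1)" and PuR: "P = u + R"
      using span_eq_iff[THEN iffD2, OF subspace_poly_space] unfolding span_Un by blast
    note sub = subspace_orth_poly_space[OF assms(1,2), of l n]
    have "u \<in> orth_poly_space \<mu> l n"
      using u QV span_minimal[OF _ sub, of "Q ` I"] by blast
    then have "R \<in> orth_poly_space \<mu> l n"
      using subspace_diff[OF sub P, of u] by (simp add: PuR)
    with R have "ball_ip \<mu> l R R = 0" by (simp add: orth_poly_space_def)
    then have "R = 0"
      using R poly_space_subset_polyfun by (intro ball_ip_self_eq_0[OF assms(1-3)]) blast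
    with u PuR show "P \<in> span (Q ` I)" by simp
  qed
  moreover have "span (Q ` I) \<subseteq> orth_poly_space \<mu> l n"
    using QV by (intro span_minimal subspace_orth_poly_space[OF assms(1,2)]) blast
  ultimately show ?thesis
    using indep orth by (auto simp: basis_family_def)
qed

end
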